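(* For all integers $m\geq 2$ and $k\geq 3$, the probability distribution $\nu_{m,k}$ on $\{0,\dots,m-1\}$ occurs as the marginal of an $S_k$-symmetric probability distribution $\tau_{m,k}$ on $T_{m-1,k}$ with $\tau_{m,k}(t)>0$ for every $t\in T_{m-1,k}$.
   Context: For integers $m\ge 2$, $k\ge 3$, let $\gamma_{m,k}\in(0,1)$ be a point at which the function $\gamma\mapsto \frac{1+\gamma+\dots+\gamma^{m-1}}{\gamma^{(m-1)/k}}$ on $(0,1)$ attains its minimum (such a point exists), and let $\nu_{m,k}$ be the probability distribution on $\{0,\dots,m-1\}$ given by $$\nu_{m,k}(i)=\frac{\gamma_{m,k}^i}{1+\gamma_{m,k}+\dots+\gamma_{m,k}^{m-1}}.$$ For integers $r\geq 0$ and $\ell\geq 2$, let $T_{r,\ell}=\{(a_1,\dots,a_\ell)\in\mathbb{Z}^\ell \mid a_1+\dots+a_\ell=r,\ a_1,\dots,a_\ell\geq 0\}$. A probability distribution $\tau$ on $T_{r,\ell}$ is $S_\ell$-symmetric if $\tau(a_1,\dots,a_\ell)=\tau(a_{\sigma(1)},\dots,a_{\sigma(\ell)})$ for all $(a_1,\dots,a_\ell)\in T_{r,\ell}$ and all permutations $\sigma\in S_\ell$. For such $\tau$, all $\ell$ coordinate projections give the same probability distribution $\mu(\tau)$ on $\{0,\dots,r\}$, called the marginal of $\tau$; explicitly $\mu(\tau)(a)=\sum_{(a,a_2,\dots,a_\ell)\in T_{r,\ell}}\tau(a,a_2,\dots,a_\ell)$. *)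

theory Defs
  imports "HOL-Probability.Probability" "HOL-Combinatorics.Combinatorics"
begin

section \<open>The distribution \<open>\<nu>\<close>\<close>

definition gamma_objective :: "nat \<Rightarrow> nat \<Rightarrow> real \<Rightarrow> real" where
  "gamma_objective m k \<gamma> = (\<Sum>i<m. \<gamma> ^ i) / \<gamma> powr ((real m - 1) / real k)"

definition is_gamma :: "nat \<Rightarrow> nat \<Rightarrow> real \<Rightarrow> bool" where
  "is_gamma m k \<gamma> \<longleftrightarrow> is_arg_min (gamma_objective m k) (\<lambda>x. x \<in> {0<..<1}) \<gamma>"

text \<open>Distributions on \<open>{0, \<dots>, m - 1}\<close> are represented as elements of \<^typ>\<open>nat pmf\<close>
  whose mass function vanishes outside this set. The lemma \<open>pmf_nu\<close> below shows that the
  argument of \<^const>\<open>embed_pmf\<close> is a probability mass function whenever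
  \<open>\<gamma> > 0\<close> and \<open>m > 0\<close>.\<close>

definition nu :: "nat \<Rightarrow> real \<Rightarrow> nat pmf" where
  "nu m \<gamma> = embed_pmf (\<lambda>i. if i < m then \<gamma> ^ i / (\<Sum>j<m. \<gamma> ^ j) else 0)"

lemma pmf_nu:
  assumes "\<gamma> > 0" "m > 0"
  shows "pmf (nu m \<gamma>) i = (if i < m then \<gamma> ^ i / (\<Sum>j<m. \<gamma> ^ j) else 0)"
  unfolding nu_def
proof (rule pmf_embed_pmf)
  have pos: "(\<Sum>j<m. \<gamma> ^ j) > 0"
    using assms by (intro sum_pos) auto
  show nonneg: "0 \<le> (if i < m then \<gamma> ^ i / (\<Sum>j<m. \<gamma> ^ j) else 0)" for i
    using pos assms by simp
  have "(\<integral>\<^sup>+i. ennreal (if i < m then \<gamma> ^ i / (\<Sum>j<m. \<gamma> ^ j) else 0) \<partial>count_space UNIV)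
      = (\<Sum>i<m. ennreal (\<gamma> ^ i / (\<Sum>j<m. \<gamma> ^ j)))"
    by (subst nn_integral_count_space'[of "{..<m}"]) auto
  also have "\<dots> = ennreal (\<Sum>i<m. \<gamma> ^ i / (\<Sum>j<m. \<gamma> ^ j))"
    using pos assms by (intro sum_ennreal) simp
  also have "(\<Sum>i<m. \<gamma> ^ i / (\<Sum>j<m. \<gamma> ^ j)) = 1"
    using pos by (simp flip: sum_divide_distrib)
  finally show "(\<integral>\<^sup>+i. ennreal (if i < m then \<gamma> ^ i / (\<Sum>j<m. \<gamma> ^ j) else 0)
      \<partial>count_space UNIV) = 1"
    by simp
qed

lemma ex_is_gamma:
  assumes m: "m \<ge> 2" and k: "k \<ge> 3"
  shows "\<exists>\<gamma>. is_gamma m k \<gamma>"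
proof -
  define c where "c = (real m - 1) / real k"
  define f where "f = gamma_objective m k"
  have f_eq: "f x = (\<Sum>i<m. x ^ i) / x powr c" for x
    by (simp add: f_def gamma_objective_def c_def)
  have c_pos: "c > 0" using m k by (simp add: c_def)
  have f_1: "f 1 = real m" by (simp add: f_eq)
  define D where "D = (\<Sum>i<m. real i) - real m * c"
  have "2 * (\<Sum>i<m. real i) = real m * (real m - 1)"
    by (induction m) (auto simp: algebra_simps)
  moreover have "real m * c < real m * ((real m - 1) / 2)"
  proof (intro mult_strict_left_mono)
    have "c \<le> (real m - 1) / 3"
      unfolding c_def using m k by (intro divide_left_mono) auto
    also have "\<dots> < (real m - 1) / 2" using m by (simp add: field_simps)
    finally show "c < (real m - 1) / 2" .
  qed (use m in auto)
  ultimately have D_pos: "D > 0" by (simp add: D_def)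
  have "((\<lambda>x. (\<Sum>i<m. x ^ i) / x powr c) has_real_derivative D) (at 1)"
    by (auto intro!: derivative_eq_intros simp: D_def)
  then have "(f has_real_derivative D) (at 1)"
    by (simp add: f_eq [abs_def])
  from DERIV_pos_inc_left[OF this D_pos]
  obtain d where d: "d > 0" "\<And>h. 0 < h \<Longrightarrow> h < d \<Longrightarrow> f (1 - h) < f 1"
    by auto
  define y where "y = 1 - min (d / 2) (1 / 2)"
  have y: "0 < y" "y < 1" "f y < real m"
    using d(1) d(2)[of "min (d / 2) (1 / 2)"] f_1 by (auto simp: y_def min_def)
  have low: "f x \<ge> 1 / x powr c" if "x > 0" for x
  proof -
    have "(\<Sum>i<1. x ^ i) \<le> (\<Sum>i<m. x ^ i)"
      using m that by (intro sum_mono2) auto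
    then show ?thesis using that by (simp add: f_eq divide_right_mono)
  qed
  define e where "e = min y (real m powr (- 1 / c))"
  have e: "0 < e" "e \<le> y" using y m by (auto simp: e_def)
  have big: "f x \<ge> real m" if "0 < x" "x < e" for x
  proof -
    have "x powr c \<le> (real m powr (- 1 / c)) powr c"
      using that c_pos by (intro powr_mono2) (auto simp: e_def)
    also have "\<dots> = real m powr (- 1)"
      using c_pos by (simp add: powr_powr)
    also have "\<dots> = 1 / real m"
      using m by (simp add: powr_minus_divide)
    finally have "real m \<le> 1 / x powr c"
      using that m by (simp add: field_simps)
    with low[of x] that show ?thesis by simp
  qed
  have "continuous_on {e..1} f"
    unfolding f_eq [abs_def] using e by (intro continuous_intros) auto
  then obtain g where g: "g \<in> {e..1}" "\<And>x. x \<in> {e..1} \<Longrightarrow> f g \<le> f x"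
    using continuous_attains_inf[of "{e..1}" f] e y by auto
  have "f g < real m" using g(2)[of y] e y by simp
  then have "g \<noteq> 1" using f_1 by auto
  have "f g \<le> f x" if "0 < x" "x < 1" for x
    using g(2)[of x] big[of x] that \<open>f g < real m\<close> by (cases "x < e") auto
  with g(1) \<open>g \<noteq> 1\<close> e have "is_arg_min f (\<lambda>x. x \<in> {0<..<1}) g"
    by (auto simp: is_arg_min_linorder)
  then show ?thesis
    by (auto simp: is_gamma_def f_def)
qed


section \<open>Symmetric distributions and their marginals\<close>

text \<open>Nonnegative integer tuples are lists of natural numbers, so coordinates are numbered
  from 0. A distribution on \<open>T r l\<close> is a \<^typ>\<open>nat list pmf\<close> with support contained
  in \<open>T r l\<close>.\<close>

definition T :: "nat \<Rightarrow> nat \<Rightarrow> nat list set" where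
  "T r l = {a. length a = l \<and> sum_list a = r}"

definition distribution_on :: "'a set \<Rightarrow> 'a pmf \<Rightarrow> bool" where
  "distribution_on A \<tau> \<longleftrightarrow> set_pmf \<tau> \<subseteq> A"

definition S_symmetric :: "nat \<Rightarrow> nat \<Rightarrow> nat list pmf \<Rightarrow> bool" where
  "S_symmetric r l \<tau> \<longleftrightarrow>
     (\<forall>a\<in>T r l. \<forall>\<sigma>. \<sigma> permutes {..<l} \<longrightarrow> pmf \<tau> a = pmf \<tau> (permute_list \<sigma> a))"

definition marginal :: "nat list pmf \<Rightarrow> nat pmf" where
  "marginal \<tau> = map_pmf (\<lambda>a. a ! 0) \<tau>"

lemma finite_T: "finite (T r l)"
proof (rule finite_subset)
  show "T r l \<subseteq> {a. set a \<subseteq> {..r} \<and> length a = l}"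
    by (auto simp: T_def intro: member_le_sum_list)
qed (simp add: finite_lists_length_eq)

lemma pmf_map_nth:
  assumes "distribution_on (T r l) \<tau>"
  shows "pmf (map_pmf (\<lambda>a. a ! j) \<tau>) x = (\<Sum>t\<in>{t\<in>T r l. t ! j = x}. pmf \<tau> t)"
proof -
  have "pmf (map_pmf (\<lambda>a. a ! j) \<tau>) x = measure \<tau> ((\<lambda>a. a ! j) -` {x})"
    by (simp add: pmf_map)
  also have "\<dots> = measure \<tau> {t\<in>T r l. t ! j = x}"
    using assms unfolding distribution_on_def
    by (intro measure_pmf.finite_measure_eq_AE) (auto simp: AE_measure_pmf_iff)
  also have "\<dots> = (\<Sum>t\<in>{t\<in>T r l. t ! j = x}. pmf \<tau> t)"
    by (intro measure_measure_pmf_finite) (simp add: finite_T)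
  finally show ?thesis .
qed

lemma pmf_marginal:
  assumes "distribution_on (T r l) \<tau>"
  shows "pmf (marginal \<tau>) x = (\<Sum>t\<in>{t\<in>T r l. t ! 0 = x}. pmf \<tau> t)"
  unfolding marginal_def by (rule pmf_map_nth[OF assms])

lemma marginal_eq_map_nth:
  assumes "distribution_on (T r l) \<tau>" and sym: "S_symmetric r l \<tau>" and j: "j < l"
  shows "map_pmf (\<lambda>a. a ! j) \<tau> = marginal \<tau>"
proof (rule pmf_eqI)
  fix x
  define \<sigma> where "\<sigma> = Transposition.transpose 0 j"
  have \<sigma>: "\<sigma> permutes {..<l}"
    using j unfolding \<sigma>_def by (intro permutes_swap_id) auto
  have inv: "permute_list \<sigma> (permute_list \<sigma> a) = a" if "length a = l" for a :: "nat list"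
  proof -
    have "permute_list (\<sigma> \<circ> \<sigma>) a = permute_list \<sigma> (permute_list \<sigma> a)"
      using \<sigma> that by (intro permute_list_compose) auto
    then show ?thesis by (simp add: \<sigma>_def)
  qed
  have closed: "permute_list \<sigma> a \<in> T r l" if "a \<in> T r l" for a
  proof -
    have "mset (permute_list \<sigma> a) = mset a"
      using \<sigma> that by (intro mset_permute_list) (auto simp: T_def)
    then have "sum_list (permute_list \<sigma> a) = sum_list a"
      by (simp flip: sum_mset_sum_list)
    with that show ?thesis
      by (simp add: T_def)
  qed
  have nth: "permute_list \<sigma> a ! i = a ! \<sigma> i" if "a \<in> T r l" "i < l" for a i
    using \<sigma> that by (intro permute_list_nth) (auto simp: T_def)
  have len: "length a = l" if "a \<in> T r l" for a
    using that by (simp add: T_def)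
  have at: "permute_list \<sigma> a ! 0 = a ! j" "permute_list \<sigma> a ! j = a ! 0" if "a \<in> T r l" for a
    using nth[OF that, of 0] nth[OF that, of j] j by (simp_all add: \<sigma>_def)
  have pmf_eq: "pmf \<tau> (permute_list \<sigma> a) = pmf \<tau> a" if "a \<in> T r l" for a
    using sym that \<sigma> by (simp add: S_symmetric_def)
  have "(\<Sum>t\<in>{t\<in>T r l. t ! j = x}. pmf \<tau> t) = (\<Sum>t\<in>{t\<in>T r l. t ! 0 = x}. pmf \<tau> t)"
    by (rule sum.reindex_bij_witness[of _ "permute_list \<sigma>" "permute_list \<sigma>"])
       (simp_all add: closed at inv len pmf_eq)
  then show "pmf (map_pmf (\<lambda>a. a ! j) \<tau>) x = pmf (marginal \<tau>) x"
    by (simp add: pmf_map_nth[OF assms(1)] pmf_marginal[OF assms(1)])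
qed

end

theory Submission
  imports Defs
begin

text \<open>
  Put \<open>r = m - 1\<close>. The mean of \<open>\<nu>\<close> is \<open>r / k\<close> because the derivative of the objective
  vanishes at \<open>\<gamma>\<close>, and \<open>\<nu>\<close> is strictly decreasing on \<open>{0, \<dots>, r}\<close>. So after subtracting a small
  multiple of the marginal of the uniform distribution on \<open>T r k\<close> a nonincreasing distribution
  with mean \<open>r / k\<close> remains, and it suffices to realize such a distribution by \<open>k\<close> variables with
  sum \<open>r\<close>: mixing the uniform distribution back in gives full support, and averaging over
  permutations gives symmetry.

  The core is the case of three variables with possibly different nonincreasing distributions on
  \<open>{0, \<dots>, r}\<close> whose means add up to \<open>r\<close>: they always have a coupling with sum \<open>r\<close>. By induction
  on \<open>r\<close>, all points at which one of the variables is \<open>0\<close> are removed so that monotonicity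
  survives. This works if the other two variables do not reach \<open>r\<close>; it is applied to the extreme
  cases, where two of the distributions are uniform on initial segments and the third is a mixture
  of two such, and the remaining extreme case has an explicit solution.

  For \<open>k \<ge> 4\<close>, two nonincreasing variables whose means add up to at most \<open>r / 2\<close> can be coupled,
  by the case of three variables, such that their sum is again nonincreasing on \<open>{0, \<dots>, r}\<close>. So
  \<open>k div 2\<close> of the variables, and likewise all but one of the others, can be merged into a single
  variable.
\<close>

section \<open>Nonincreasing functions and realizable triples\<close>

text \<open>Monotonicity is required on all of \<open>nat\<close>, so vanishing beyond
  \<open>r\<close> already makes the values nonnegative. The total mass is left free, so that these
  functions form a cone.\<close>

definition noninc :: "nat \<Rightarrow> (nat \<Rightarrow> real) \<Rightarrow> bool" where
  "noninc r f \<longleftrightarrow> antimono f \<and> (\<forall>x>r. f x = 0)"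

lemma noninc_nonneg: "noninc r f \<Longrightarrow> 0 \<le> f x"
proof -
  assume f: "noninc r f"
  then have "f (max x (Suc r)) \<le> f x"
    by (intro antimonoD[where f = f]) (auto simp: noninc_def)
  with f show ?thesis by (auto simp: noninc_def max_def split: if_splits)
qed

lemma noninc_mono: "noninc r f \<Longrightarrow> x \<le> y \<Longrightarrow> f y \<le> f x"
  by (auto simp: noninc_def antimono_def)

lemma noninc_Suc: "noninc r f \<Longrightarrow> f (Suc x) \<le> f x"
  by (rule noninc_mono) simp_all

lemma noninc_eq_0: "noninc r f \<Longrightarrow> r < x \<Longrightarrow> f x = 0"
  by (auto simp: noninc_def)

lemma nonincI:
  "(\<And>x. f (Suc x) \<le> f x) \<Longrightarrow> (\<And>x. r < x \<Longrightarrow> f x = 0) \<Longrightarrow> noninc r f"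
  unfolding noninc_def by (auto simp: antimono_iff_le_Suc)

lemma noninc_zero: "noninc r (\<lambda>x. 0)"
  by (rule nonincI) auto

lemma noninc_add: "noninc r f \<Longrightarrow> noninc r g \<Longrightarrow> noninc r (\<lambda>x. f x + g x)"
  by (rule nonincI) (auto simp: noninc_eq_0 intro!: add_mono intro: noninc_Suc)

lemma noninc_scale: "0 \<le> c \<Longrightarrow> noninc r f \<Longrightarrow> noninc r (\<lambda>x. c * f x)"
  by (rule nonincI) (auto simp: noninc_eq_0 intro!: mult_left_mono intro: noninc_Suc)

lemma noninc_sum:
  "(\<And>a. a \<in> A \<Longrightarrow> noninc r (f a)) \<Longrightarrow> noninc r (\<lambda>x. \<Sum>a\<in>A. f a x)"
  by (induction A rule: infinite_finite_induct) (simp_all add: noninc_zero noninc_add)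

section \<open>Uniform distributions on initial segments\<close>

definition uni :: "nat \<Rightarrow> nat \<Rightarrow> real" where
  "uni a x = (if x \<le> a then 1 / (real a + 1) else 0)"

lemma noninc_uni: "a \<le> r \<Longrightarrow> noninc r (uni a)"
  by (rule nonincI) (auto simp: uni_def)

lemma sum_real_atMost: "(\<Sum>x\<le>a. real x) = real a * (real a + 1) / 2"
  by (induction a) (auto simp: field_simps)

lemma sum_uni: "a \<le> r \<Longrightarrow> (\<Sum>x\<le>r. uni a x) = 1"
proof -
  assume "a \<le> r"
  then have "(\<Sum>x\<le>r. uni a x) = (\<Sum>x\<le>a. 1 / (real a + 1))"
    by (intro sum.mono_neutral_cong_right) (auto simp: uni_def)
  then show ?thesis by (simp add: field_simps)
qed

lemma moment_uni: "a \<le> r \<Longrightarrow> (\<Sum>x\<le>r. real x * uni a x) = real a / 2"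
proof -
  assume "a \<le> r"
  then have "(\<Sum>x\<le>r. real x * uni a x) = (\<Sum>x\<le>a. real x * (1 / (real a + 1)))"
    by (intro sum.mono_neutral_cong_right) (auto simp: uni_def)
  also have "\<dots> = (\<Sum>x\<le>a. real x) * (1 / (real a + 1))"
    by (rule sum_distrib_right[symmetric])
  also have "\<dots> = (real a * (real a + 1)) / (2 * (real a + 1))"
    by (simp add: sum_real_atMost)
  also have "\<dots> = real a / 2"
    by (rule mult_divide_mult_cancel_right) simp
  finally show ?thesis .
qed

text \<open>Layer-cake decomposition: the segment from \<open>0\<close> to \<open>a\<close> carries
  the height \<open>f a - f (Suc a)\<close>, and the heights telescope. So the uniform distributions
  generate the cone of nonincreasing functions.\<close>

lemma noninc_eq_sum_uni:
  assumes f: "noninc r f"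
  shows "f x = (\<Sum>a\<le>r. (real a + 1) * (f a - f (Suc a)) * uni a x)"
proof -
  have "(\<Sum>a\<le>r. (real a + 1) * (f a - f (Suc a)) * uni a x)
      = (\<Sum>a\<in>{x..r}. f a - f (Suc a))"
    by (intro sum.mono_neutral_cong_right) (auto simp: uni_def)
  also have "\<dots> = f x"
  proof (cases "x \<le> r")
    case True
    then have "(\<Sum>a\<in>{x..r}. f a - f (Suc a)) = f x - f (Suc r)"
      by (induction r rule: dec_induct) (auto simp: sum.atLeast_Suc_atMost)
    with noninc_eq_0[OF f, of "Suc r"] show ?thesis by simp
  qed (use noninc_eq_0[OF f] in auto)
  finally show ?thesis by simp
qed

text \<open>\<open>F\<close> is the triple of marginals of a finite measure on points
  \<open>t\<close> whose three coordinates add up to \<open>r\<close>. Building the measure from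
  point masses without normalisation gives a convex cone, in which triples can be split and
  reassembled.\<close>

inductive realizable :: "nat \<Rightarrow> (3 \<Rightarrow> nat \<Rightarrow> real) \<Rightarrow> bool" for r where
  zero: "realizable r (\<lambda>i x. 0)"
| step: "realizable r F \<Longrightarrow> 0 \<le> c \<Longrightarrow> (\<Sum>i\<in>UNIV. t i) = r
    \<Longrightarrow> realizable r (\<lambda>i x. F i x + (if x = t i then c else 0))"

lemma realizable_point:
  "0 \<le> c \<Longrightarrow> (\<Sum>i\<in>UNIV. t i) = r \<Longrightarrow> realizable r (\<lambda>i x. if x = t i then c else 0)"
  using realizable.step[OF realizable.zero] by simp

lemma realizable_add: "realizable r F \<Longrightarrow> realizable r G \<Longrightarrow> realizable r (\<lambda>i x. F i x + G i x)"
proof (rotate_tac, induction rule: realizable.induct)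
  case (step G c t)
  from realizable.step[OF step(4)[OF step(5)] step(2,3)] show ?case
    by (simp add: add.assoc)
qed simp

lemma realizable_scale: "0 \<le> a \<Longrightarrow> realizable r F \<Longrightarrow> realizable r (\<lambda>i x. a * F i x)"
proof (rotate_tac, induction rule: realizable.induct)
  case (step F c t)
  from step have "realizable r (\<lambda>i x. a * F i x + (if x = t i then a * c else 0))"
    by (intro realizable.step) auto
  also have "(\<lambda>i x. a * F i x + (if x = t i then a * c else 0))
      = (\<lambda>i x. a * (F i x + (if x = t i then c else 0)))"
    by (auto simp: fun_eq_iff distrib_left)
  finally show ?case .
qed (simp add: realizable.zero)

lemma realizable_sum:
  "(\<And>a. a \<in> A \<Longrightarrow> realizable r (F a)) \<Longrightarrow> realizable r (\<lambda>i x. \<Sum>a\<in>A. F a i x)"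
  by (induction A rule: infinite_finite_induct) (simp_all add: realizable.zero realizable_add)

text \<open>Adding \<open>n\<close> to coordinate \<open>i\<close> of every point raises all
  coordinate sums by \<open>n\<close>. This is how solutions for smaller sums are reused.\<close>

lemma realizable_shift:
  "realizable r F \<Longrightarrow> realizable (r + n) (F(i := \<lambda>x. if x < n then 0 else F i (x - n)))"
proof (induction rule: realizable.induct)
  case zero
  have "(\<lambda>i x. 0)(i := \<lambda>x. if x < n then 0 else 0) = (\<lambda>(i::3) (x::nat). 0::real)"
    by auto
  then show ?case by (simp only: realizable.zero)
next
  case (step F c t)
  have "(\<Sum>j\<in>UNIV. (t(i := t i + n)) j) = r + n"
    using step(3) by (simp add: sum.remove[of UNIV i])
  from realizable.step[OF step(4,2) this] show ?case
    by (rule back_subst[of "realizable _"]) (auto simp: fun_eq_iff)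
qed

text \<open>The coordinate sum is \<open>r\<close> at every point, so its integral is
  \<open>r\<close> times the total mass, which can be read off from any coordinate
  \<open>j\<close>.\<close>

lemma realizable_moment:
  assumes "realizable r F"
  shows "(\<Sum>i\<in>UNIV. \<Sum>x\<le>r. real x * F i x) = real r * (\<Sum>x\<le>r. F j x)"
  using assms
proof (induction rule: realizable.induct)
  case (step F c t)
  have le: "t i \<le> r" for i
    using step(3) member_le_sum[of i UNIV t] by auto
  have *: "real x * (F i x + (if x = t i then c else 0))
     = real x * F i x + (if x = t i then real x * c else 0)" for i x
    by (simp add: distrib_left)
  have "real (\<Sum>i\<in>UNIV. t i) = real r" using step(3) by simp
  then have "(\<Sum>i\<in>UNIV. real (t i)) = real r" by simp
  then show ?case
    unfolding * using step.IH le
    by (simp add: sum.distrib distrib_left flip: sum_distrib_right)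
qed simp

section \<open>Comparison of means by Chebyshev's sum inequality\<close>

lemma moment_noninc_le:
  fixes a :: "nat \<Rightarrow> real"
  assumes "\<And>i j. i \<le> j \<Longrightarrow> j < n \<Longrightarrow> a j \<le> a i"
  shows "2 * (\<Sum>x<n. real x * a x) \<le> (real n - 1) * (\<Sum>x<n. a x)"
proof (cases n)
  case (Suc m)
  have "real n * (\<Sum>x<n. real x * a x) \<le> (\<Sum>x<n. real x) * (\<Sum>x<n. a x)"
    using Chebyshev_sum_upper[of n real a] assms by (simp add: atLeast0LessThan)
  also have "(\<Sum>x<n. real x) = real n * (real n - 1) / 2"
    using sum_real_atMost[of m] by (simp add: Suc lessThan_Suc_atMost)
  finally have "real n * (2 * (\<Sum>x<n. real x * a x)) \<le> real n * ((real n - 1) * (\<Sum>x<n. a x))"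
    by (simp add: field_simps)
  then show ?thesis by (subst (asm) mult_le_cancel_left_pos) (simp_all add: Suc)
qed simp

text \<open>The right-hand side is the most mass that points with coordinates \<open>0\<close>,
  \<open>y\<close>, \<open>r - y\<close> can take from \<open>f\<close> and \<open>g\<close>, and
  \<open>h 0\<close> has to be placed there. The excess \<open>f y - g (r - y)\<close> is
  nonincreasing in \<open>y\<close>, so Chebyshev's inequality bounds the mass of its positive part
  by its moment, which the moment condition ties to \<open>h\<close>.\<close>

lemma head_le_sum_min:
  assumes f: "noninc r f" and g: "noninc r g" and h: "noninc r h"
    and mf: "(\<Sum>x\<le>r. f x) = M" and mg: "(\<Sum>x\<le>r. g x) = M" and mh: "(\<Sum>x\<le>r. h x) = M"
    and mom: "(\<Sum>x\<le>r. real x * f x) + (\<Sum>x\<le>r. real x * g x) + (\<Sum>x\<le>r. real x * h x) = real r * M"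
  shows "h 0 \<le> (\<Sum>y\<le>r. min (f y) (g (r - y)))"
proof -
  \<comment> \<open>Without its value at \<open>0\<close>, \<open>h\<close> has mean at most
    \<open>(r + 1) / 2\<close>, the mean of the uniform distribution on
    \<open>{1..r}\<close>.\<close>
  have tail: "2 * (\<Sum>x\<le>r. real x * h x) \<le> (real r + 1) * (M - h 0)"
  proof -
    have split0: "(\<Sum>x\<le>r. k x) = k 0 + (\<Sum>x<r. k (Suc x))" for k :: "nat \<Rightarrow> real"
      by (rule sum.atMost_shift)
    have "2 * (\<Sum>x<r. real x * h (Suc x)) \<le> (real r - 1) * (\<Sum>x<r. h (Suc x))"
      by (rule moment_noninc_le) (auto intro: noninc_mono[OF h])
    moreover have "(\<Sum>x<r. h (Suc x)) = M - h 0"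
      using mh split0[of h] by simp
    moreover have "(\<Sum>x\<le>r. real x * h x) = (\<Sum>x<r. real x * h (Suc x)) + (\<Sum>x<r. h (Suc x))"
      using split0[of "\<lambda>x. real x * h x"] by (simp add: distrib_right sum.distrib)
    ultimately show ?thesis by (simp add: algebra_simps)
  qed
  define D where "D y = f y - g (r - y)" for y
  have D_mono: "D y' \<le> D y" if "y \<le> y'" for y y'
    using noninc_mono[OF f that] noninc_mono[OF g diff_le_mono2[OF that, of r]]
    by (simp add: D_def)
  \<comment> \<open>\<open>D\<close> is positive below \<open>s\<close> and at most \<open>0\<close>
    from \<open>s\<close> to \<open>r\<close>. The disjunct \<open>y > r\<close> makes the least
    element exist and gives \<open>s = Suc r\<close> if \<open>D\<close> stays positive.\<close>
  define s where "s = (LEAST y. y > r \<or> D y \<le> 0)"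
  have s_le: "s \<le> Suc r" unfolding s_def by (rule Least_le) simp
  have D_pos: "D y > 0" if "y < s" for y
    using not_less_Least[of y "\<lambda>y. y > r \<or> D y \<le> 0"] that by (simp add: s_def)
  have "s > r \<or> D s \<le> 0" unfolding s_def by (rule LeastI[of _ "Suc r"]) simp
  then have D_neg: "D y \<le> 0" if "s \<le> y" "y \<le> r" for y
    using that D_mono[of s y] by auto
  have refl: "(\<Sum>y\<le>r. k (r - y)) = (\<Sum>y\<le>r. k y)" for k :: "nat \<Rightarrow> real"
    by (rule sum.reindex_bij_witness[of _ "\<lambda>y. r - y" "\<lambda>y. r - y"]) auto
  define n where "n = Suc r - s"
  have rs: "real s + real n = real r + 1" using s_le by (simp add: n_def)
  have split: "(\<Sum>y\<le>r. k y) = (\<Sum>y<s. k y) + (\<Sum>x<n. k (s + x))" for k :: "nat \<Rightarrow> real"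
  proof -
    have "(\<Sum>y\<le>r. k y) = (\<Sum>y\<in>{..<s} \<union> {s..<s+n}. k y)"
      using s_le by (intro sum.cong) (auto simp: n_def)
    also have "\<dots> = (\<Sum>y<s. k y) + (\<Sum>y\<in>{s..<s+n}. k y)"
      by (rule sum.union_disjoint) auto
    also have "(\<Sum>y\<in>{s..<s+n}. k y) = (\<Sum>x<n. k (s + x))"
      by (rule sum.reindex_bij_witness[of _ "\<lambda>x. s + x" "\<lambda>y. y - s"]) auto
    finally show ?thesis .
  qed
  define t where "t = (\<Sum>y<s. D y)"
  have "(\<Sum>y\<le>r. D y) = 0"
    using refl[of g] mf mg by (simp add: D_def sum_subtractf)
  then have t': "(\<Sum>x<n. D (s + x)) = - t"
    using split[of D] by (simp add: t_def)
  \<comment> \<open>After reflecting \<open>g\<close>, the moment condition makes the moment of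
    \<open>D\<close> equal to minus that of \<open>h\<close>.\<close>
  have "(\<Sum>y\<le>r. real y * D y) = (\<Sum>y\<le>r. real y * f y) - (\<Sum>y\<le>r. real y * g (r - y))"
    by (simp add: D_def algebra_simps sum_subtractf)
  also have "(\<Sum>y\<le>r. real y * g (r - y)) = (\<Sum>y\<le>r. real (r - y) * g y)"
    using refl[of "\<lambda>y. real (r - y) * g y"] by simp
  also have "\<dots> = (\<Sum>y\<le>r. real r * g y - real y * g y)"
    by (intro sum.cong) (auto simp: of_nat_diff left_diff_distrib)
  also have "\<dots> = real r * M - (\<Sum>y\<le>r. real y * g y)"
    by (simp add: sum_subtractf mg flip: sum_distrib_left)
  finally have mD: "(\<Sum>y\<le>r. real y * D y) = - (\<Sum>x\<le>r. real x * h x)"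
    using mom by simp
  \<comment> \<open>\<open>D\<close> is nonincreasing on the first \<open>s\<close> places, where
    its sum is \<open>t\<close>, and on the other \<open>n\<close> places, where its sum is
    \<open>- t\<close>. On each block its moment is at most that of a constant with the same
    sum.\<close>
  have "2 * (\<Sum>y<s. real y * D y) \<le> (real s - 1) * t"
    unfolding t_def by (rule moment_noninc_le) (rule D_mono)
  moreover have "2 * (\<Sum>x<n. real x * D (s + x)) \<le> (real n - 1) * (- t)"
    unfolding t'[symmetric] by (rule moment_noninc_le) (rule D_mono, simp)
  moreover have "(\<Sum>x<n. real (s + x) * D (s + x)) = real s * (- t) + (\<Sum>x<n. real x * D (s + x))"
    unfolding t'[symmetric] by (simp add: distrib_right sum.distrib sum_distrib_left)
  ultimately have "2 * (\<Sum>y\<le>r. real y * D y) \<le> (real s - 1) * t - 2 * real s * t - (real n - 1) * t"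
    unfolding split[of "\<lambda>y. real y * D y"] by simp
  also have "\<dots> = - ((real s + real n) * t)"
    by (simp add: algebra_simps)
  finally have "(real r + 1) * t \<le> 2 * (\<Sum>x\<le>r. real x * h x)"
    unfolding mD rs by simp
  with tail have "(real r + 1) * t \<le> (real r + 1) * (M - h 0)" by linarith
  then have t_le: "t \<le> M - h 0" by (rule mult_left_le_imp_le) simp
  \<comment> \<open>What the minimum leaves of \<open>f\<close> is the positive part of
    \<open>D\<close>, of mass \<open>t\<close>.\<close>
  have "(\<Sum>y\<le>r. f y - min (f y) (g (r - y))) = (\<Sum>y<s. D y) + (\<Sum>x<n. 0)"
    unfolding split
  proof (intro arg_cong2[of _ _ _ _ "(+)"] sum.cong refl)
    show "f y - min (f y) (g (r - y)) = D y" if "y \<in> {..<s}" for y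
      using D_pos[of y] that by (simp add: D_def)
    show "f (s + x) - min (f (s + x)) (g (r - (s + x))) = 0" if "x \<in> {..<n}" for x
      using D_neg[of "s + x"] that by (auto simp: D_def n_def)
  qed (rule HOL.refl)+
  with t_le mf show ?thesis by (simp add: t_def sum_subtractf)
qed

section \<open>Removing a layer\<close>

lemma UNIV_3_eq:
  fixes i j k :: 3
  assumes "i \<noteq> j" "i \<noteq> k" "j \<noteq> k"
  shows "UNIV = {i, j, k}"
  using assms by (intro card_subset_eq[symmetric]) auto

lemma sum_UNIV_3:
  fixes i j k :: 3
  assumes "i \<noteq> j" "i \<noteq> k" "j \<noteq> k"
  shows "(\<Sum>l\<in>UNIV. f l) = f i + (f j + (f k :: 'a :: comm_monoid_add))"
  using assms by (simp add: UNIV_3_eq[OF assms])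

text \<open>Equal masses and a coordinate sum of average \<open>r\<close> are necessary for
  realizability. Together with monotonicity they turn out to be sufficient in
  \<open>realizable_balanced\<close>.\<close>

definition balanced :: "nat \<Rightarrow> real \<Rightarrow> (3 \<Rightarrow> nat \<Rightarrow> real) \<Rightarrow> bool" where
  "balanced r M F \<longleftrightarrow> (\<forall>i. noninc r (F i)) \<and> (\<forall>i. (\<Sum>x\<le>r. F i x) = M) \<and>
     (\<Sum>i\<in>UNIV. \<Sum>x\<le>r. real x * F i x) = real r * M"

lemma sum_noninc_extend:
  assumes "noninc s f" "s \<le> r"
  shows "(\<Sum>x\<le>s. c x * f x) = (\<Sum>x\<le>r. c x * f x)"
  using assms by (intro sum.mono_neutral_left) (auto simp: noninc_eq_0)

text \<open>The points with coordinate \<open>i\<close> equal to \<open>0\<close> get the masses \<open>H\<close>. As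
  \<open>f - \<theta> * min f g\<close> is a combination of \<open>f\<close> and \<open>max 0 (f - g)\<close>, subtracting \<open>H\<close> keeps the other two
  functions nonincreasing.\<close>

lemma realizable_strip:
  assumes r: "0 < r"
    and IH: "\<And>F' M'. balanced (r - 1) M' F' \<Longrightarrow> realizable (r - 1) F'"
    and dist: "i \<noteq> j" "i \<noteq> k" "j \<noteq> k"
    and F: "balanced r M F" and top: "F j r = 0" "F k r = 0"
  shows "realizable r F"
proof -
  note UN = UNIV_3_eq[OF dist] and SU = sum_UNIV_3[OF dist]
  have ni: "noninc r (F l)" and mass: "(\<Sum>x\<le>r. F l x) = M" for l
    using F by (auto simp: balanced_def)
  have mom: "(\<Sum>x\<le>r. real x * F i x) + ((\<Sum>x\<le>r. real x * F j x) + (\<Sum>x\<le>r. real x * F k x)) = real r * M"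
    using F by (simp add: balanced_def SU)
  have nonneg: "0 \<le> F l x" for l x using noninc_nonneg[OF ni] .
  have top': "F j x = 0" "F k x = 0" if "r \<le> x" for x
    using top noninc_eq_0[OF ni, of x] that by (cases "x = r"; simp)+
  define m where "m = (\<Sum>y\<le>r. min (F j y) (F k (r - y)))"
  have m: "F i 0 \<le> m"
    unfolding m_def using mom by (intro head_le_sum_min[of r _ _ _ M] ni mass) simp
  \<comment> \<open>Only the fraction of the available mass \<open>m\<close> that exhausts
    \<open>F i 0\<close> is used. If \<open>m = 0\<close>, then \<open>F i 0 = 0\<close> as
    well.\<close>
  define \<theta> where "\<theta> = (if m = 0 then 0 else F i 0 / m)"
  have \<theta>: "0 \<le> \<theta>" "\<theta> \<le> 1" "\<theta> * m = F i 0"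
    using m nonneg[of i 0] by (auto simp: \<theta>_def divide_simps)
  have scale: "\<theta> * d \<le> e" if "d \<le> e" "0 \<le> e" for d e
    using mult_left_mono[OF that(1) \<theta>(1)] mult_right_mono[OF \<theta>(2) that(2)] by simp
  define H where "H y = \<theta> * min (F j y) (F k (r - y))" for y
  have sum_H: "(\<Sum>y\<le>r. H y) = F i 0"
    using \<theta>(3) by (simp add: H_def m_def sum_distrib_left)
  \<comment> \<open>As \<open>F j\<close> and \<open>F k\<close> vanish at \<open>r\<close>, no mass
    is placed at the ends \<open>y = 0\<close> and \<open>y = r\<close>.\<close>
  have H0: "H x = 0" "H (r - x) = 0" if "r \<le> x" for x
    using top'[OF that] top'[of r] that nonneg[of j 0] nonneg[of k 0] nonneg[of k "r - x"]
    by (auto simp: H_def min_def)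
  \<comment> \<open>The remainder, to be placed on points with coordinate \<open>i\<close> at least
    \<open>1\<close>. Lowering that coordinate by one leaves a problem for the sum
    \<open>r - 1\<close>.\<close>
  define F' where "F' l = (if l = i then \<lambda>x. F i (Suc x)
      else if l = j then \<lambda>x. F j x - H x else (\<lambda>x. F k x - H (r - x)))" for l
  have F': "F' i = (\<lambda>x. F i (Suc x))" "F' j = (\<lambda>x. F j x - H x)" "F' k = (\<lambda>x. F k x - H (r - x))"
    using dist by (auto simp: F'_def)
  have reflect: "(\<Sum>y\<le>r. g (r - y)) = (\<Sum>y\<le>r. g y)" for g :: "nat \<Rightarrow> real"
    by (rule sum.reindex_bij_witness[of _ "\<lambda>y. r - y" "\<lambda>y. r - y"]) auto
  have "noninc (r - 1) (F' i)"
    unfolding F' by (rule nonincI) (use noninc_Suc[OF ni] noninc_eq_0[OF ni] in auto)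
  moreover have "noninc (r - 1) (F' j)"
    unfolding F'
  proof (rule nonincI)
    fix x
    \<comment> \<open>The second argument of \<open>min\<close> grows with \<open>x\<close>, so the
      minimum falls by no more than its first argument does.\<close>
    have "F k (r - x) \<le> F k (r - Suc x)" by (rule noninc_mono[OF ni]) simp
    then have "\<theta> * (min (F j x) (F k (r - x)) - min (F j (Suc x)) (F k (r - Suc x))) \<le> F j x - F j (Suc x)"
      using noninc_Suc[OF ni[of j], of x] by (intro scale) auto
    then show "F j (Suc x) - H (Suc x) \<le> F j x - H x"
      by (simp add: H_def right_diff_distrib)
  qed (use top' H0 in auto)
  moreover have "noninc (r - 1) (F' k)"
    unfolding F'
  proof (rule nonincI)
    fix x
    show "F k (Suc x) - H (r - Suc x) \<le> F k x - H (r - x)"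
    proof (cases "r \<le> x")
      case True
      then show ?thesis using top' H0[of x] H0[of "Suc x"] by simp
    next
      case False
      have "F j (r - x) \<le> F j (r - Suc x)" by (rule noninc_mono[OF ni]) simp
      then have "\<theta> * (min (F j (r - x)) (F k x) - min (F j (r - Suc x)) (F k (Suc x))) \<le> F k x - F k (Suc x)"
        using noninc_Suc[OF ni[of k], of x] by (intro scale) auto
      with False show ?thesis
        by (simp add: H_def right_diff_distrib)
    qed
  qed (use top' H0 in auto)
  ultimately have ni': "noninc (r - 1) (F' l)" for l
    using UNIV_I[of l] unfolding UN by blast
  have ext: "(\<Sum>x\<le>r - 1. c x * F' l x) = (\<Sum>x\<le>r. c x * F' l x)" for l c
    by (rule sum_noninc_extend[OF ni']) simp
  have shift0: "(\<Sum>x\<le>r. g (Suc x) * F i (Suc x)) = (\<Sum>x\<le>r. g x * F i x) - g 0 * F i 0" for g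
  proof -
    have "(\<Sum>x\<le>Suc r. g x * F i x) = g 0 * F i 0 + (\<Sum>x\<le>r. g (Suc x) * F i (Suc x))"
      by (rule sum.atMost_Suc_shift)
    then show ?thesis by (simp add: noninc_eq_0[OF ni])
  qed
  have mass_i: "(\<Sum>x\<le>r. F i (Suc x)) = M - F i 0"
    using shift0[of "\<lambda>_. 1"] mass by simp
  have mom_i: "(\<Sum>x\<le>r. real x * F i (Suc x)) = (\<Sum>x\<le>r. real x * F i x) - (M - F i 0)"
  proof -
    have "(\<Sum>x\<le>r. real x * F i (Suc x)) = (\<Sum>x\<le>r. real (Suc x) * F i (Suc x)) - (\<Sum>x\<le>r. F i (Suc x))"
      by (simp add: distrib_right sum.distrib)
    then show ?thesis unfolding mass_i using shift0[of real] by simp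
  qed
  have mom_H: "(\<Sum>x\<le>r. real x * H x) + (\<Sum>x\<le>r. real x * H (r - x)) = real r * F i 0"
  proof -
    have "(\<Sum>x\<le>r. real x * H (r - x)) = (\<Sum>x\<le>r. real (r - x) * H x)"
      using reflect[of "\<lambda>x. real (r - x) * H x"] by simp
    moreover have "(\<Sum>x\<le>r. real x * H x) + (\<Sum>x\<le>r. real (r - x) * H x) = (\<Sum>x\<le>r. real r * H x)"
      unfolding sum.distrib[symmetric] by (rule sum.cong) (auto simp: of_nat_diff algebra_simps)
    ultimately show ?thesis by (simp add: sum_H flip: sum_distrib_left)
  qed
  have "balanced (r - 1) (M - F i 0) F'"
    unfolding balanced_def
  proof (intro conjI allI)
    have "(\<Sum>x\<le>r. F' l x) = M - F i 0" if "l \<in> {i, j, k}" for l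
      using that mass mass_i sum_H reflect[of H] by (auto simp: F' sum_subtractf)
    then show "(\<Sum>x\<le>r - 1. F' l x) = M - F i 0" for l
      using UNIV_I[of l] ext[of "\<lambda>_. 1" l] unfolding UN by simp
    \<comment> \<open>Lowering coordinate \<open>i\<close> costs its remaining mass
      \<open>M - F i 0\<close>; the removed points, of mass \<open>F i 0\<close>, cost
      \<open>r\<close> per unit of mass.\<close>
    have "(\<Sum>i\<in>UNIV. \<Sum>x\<le>r. real x * F' i x) = real r * M - (M - F i 0) - real r * F i 0"
      using mom mom_H by (simp add: SU F' mom_i right_diff_distrib sum_subtractf)
    then show "(\<Sum>i\<in>UNIV. \<Sum>x\<le>r - 1. real x * F' i x) = real (r - 1) * (M - F i 0)"
      unfolding ext using r by (simp add: of_nat_diff algebra_simps)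
  qed (rule ni')
  from realizable_shift[OF IH[OF this], of 1 i] r
  have 1: "realizable r (F'(i := \<lambda>x. if x < 1 then 0 else F' i (x - 1)))" by simp
  define t where "t y l = (if l = i then 0 else if l = j then y else r - y)" for y l
  have 2: "realizable r (\<lambda>l x. \<Sum>y\<le>r. if x = t y l then H y else 0)"
  proof (rule realizable_sum, rule realizable_point)
    fix y assume "y \<in> {..r}"
    then show "(\<Sum>l\<in>UNIV. t y l) = r" using dist by (simp add: SU t_def)
    show "0 \<le> H y" using \<theta>(1) nonneg by (simp add: H_def)
  qed
  have "(F'(i := \<lambda>x. if x < 1 then 0 else F' i (x - 1))) l x + (\<Sum>y\<le>r. if x = t y l then H y else 0) = F l x" for l x
  proof -
    consider "l = i" | "l = j" | "l = k" using UNIV_I[of l] unfolding UN by blast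
    then show ?thesis
    proof cases
      case 1
      then show ?thesis using sum_H by (cases "x = 0") (auto simp: t_def F')
    next
      case 2
      then have "(\<Sum>y\<le>r. if x = t y l then H y else 0) = H x"
        using dist H0[of x] by (simp add: t_def)
      then show ?thesis using 2 dist by (simp add: F')
    next
      case 3
      then have "(\<Sum>y\<le>r. if x = t y l then H y else 0) = (\<Sum>y\<le>r. if r - y = x then H (r - (r - y)) else 0)"
        using dist by (intro sum.cong) (auto simp: t_def)
      also have "\<dots> = (\<Sum>y\<le>r. if y = x then H (r - y) else 0)"
        by (rule reflect)
      also have "\<dots> = H (r - x)" using H0[of x] by simp
      finally show ?thesis using 3 dist by (simp add: F')
    qed
  qed
  with realizable_add[OF 1 2] show ?thesis by simp
qed

section \<open>Balanced triples of mixtures of uniform distributions\<close>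

definition tri :: "3 \<Rightarrow> 3 \<Rightarrow> 'a \<Rightarrow> 'a \<Rightarrow> 'a \<Rightarrow> 3 \<Rightarrow> 'a" where
  "tri i j f g h l = (if l = i then f else if l = j then g else h)"

lemma tri_simps:
  assumes "i \<noteq> j" "i \<noteq> k" "j \<noteq> k"
  shows "tri i j f g h i = f" "tri i j f g h j = g" "tri i j f g h k = h"
  using assms by (auto simp: tri_def)

lemma tri_cases:
  assumes "i \<noteq> j" "i \<noteq> k" "j \<noteq> (k :: 3)"
  obtains "l = i" | "l = j" | "l = k"
  using UNIV_I[of l] unfolding UNIV_3_eq[OF assms] by blast

lemma balanced_tri:
  assumes dist: "i \<noteq> j" "i \<noteq> k" "j \<noteq> k"
    and "noninc r f" "noninc r g" "noninc r h"
    and "(\<Sum>x\<le>r. f x) = M" "(\<Sum>x\<le>r. g x) = M" "(\<Sum>x\<le>r. h x) = M"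
    and "(\<Sum>x\<le>r. real x * f x) + ((\<Sum>x\<le>r. real x * g x) + (\<Sum>x\<le>r. real x * h x)) = real r * M"
  shows "balanced r M (tri i j f g h)"
  using assms unfolding balanced_def sum_UNIV_3[OF dist] tri_simps[OF dist]
  by (auto simp: tri_def)

lemma balanced_uni:
  assumes dist: "i \<noteq> j" "i \<noteq> k" "j \<noteq> k"
    and "a \<le> r" "b \<le> r" "c \<le> r" "a + b + c = 2 * r"
  shows "balanced r 1 (tri i j (uni a) (uni b) (uni c))"
proof (rule balanced_tri[OF dist])
  have "real a + real b + real c = 2 * real r"
    using assms by linarith
  then show "(\<Sum>x\<le>r. real x * uni a x) + ((\<Sum>x\<le>r. real x * uni b x) + (\<Sum>x\<le>r. real x * uni c x)) = real r * 1"
    using assms by (simp add: moment_uni)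
qed (use assms in \<open>auto simp: noninc_uni sum_uni\<close>)

text \<open>If \<open>y\<close> is uniform, so is \<open>r - y\<close>, which leaves
  \<open>0\<close> for the third coordinate. Two of the functions are positive at \<open>r\<close>,
  so \<open>realizable_strip\<close> does not apply to this triple.\<close>

lemma realizable_uni_antithetic:
  assumes dist: "i \<noteq> j" "i \<noteq> k" "j \<noteq> k"
  shows "realizable r (tri i j (uni r) (uni r) (uni 0))"
proof -
  have "realizable r (\<lambda>l x. \<Sum>y\<le>r. if x = tri i j y (r - y) 0 l then 1 / (real r + 1) else 0)"
    by (intro realizable_sum realizable_point) (auto simp: sum_UNIV_3[OF dist] tri_simps[OF dist])
  also have "(\<lambda>l x. \<Sum>y\<le>r. if x = tri i j y (r - y) 0 l then 1 / (real r + 1) else 0)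
      = tri i j (uni r) (uni r) (uni 0)"
  proof (intro ext)
    fix l x
    show "(\<Sum>y\<le>r. if x = tri i j y (r - y) 0 l then 1 / (real r + 1) else 0)
      = tri i j (uni r) (uni r) (uni 0) l x"
    proof (cases rule: tri_cases[OF dist, of l])
      case 2
      have "(\<Sum>y\<le>r. if x = r - y then 1 / (real r + 1) else 0) = (\<Sum>y\<le>r. if x = y then 1 / (real r + 1) else 0)"
        by (rule sum.reindex_bij_witness[of _ "\<lambda>y. r - y" "\<lambda>y. r - y"]) auto
      with 2 show ?thesis by (simp add: tri_simps[OF dist] uni_def)
    qed (auto simp: tri_simps[OF dist] uni_def)
  qed
  finally show ?thesis .
qed

text \<open>Write \<open>r = y + c + e + 1\<close> and cut the range of coordinate \<open>j\<close> at \<open>e + 1\<close> and that of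
  coordinate \<open>i\<close> at \<open>c + 1\<close>: in the upper part of the former and the lower part of the latter, as
  well as in the two opposite parts, all three coordinates are uniform.\<close>

lemma realizable_two_tops:
  assumes IH: "\<And>s M F. s < r \<Longrightarrow> balanced s M F \<Longrightarrow> realizable s F"
    and dist: "i \<noteq> j" "i \<noteq> k" "j \<noteq> k"
    and le: "c \<le> r" and \<alpha>\<beta>: "0 \<le> \<alpha>" "0 < \<beta>" "\<alpha> + \<beta> = 1"
    and bal: "\<alpha> * real c + \<beta> * real r + real y = real r"
  shows "realizable r (tri i j (\<lambda>z. \<alpha> * uni c z + \<beta> * uni r z) (uni r) (uni y))"
proof (cases "y = 0")
  case True
  have "\<alpha> * (real r - real c) = (\<alpha> + \<beta>) * real r - (\<alpha> * real c + \<beta> * real r)"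
    by (simp add: algebra_simps)
  also have "\<dots> = 0"
    using bal True unfolding \<alpha>\<beta>(3) by simp
  finally have "\<alpha> * (real r - real c) = 0" .
  then have "\<alpha> = 0 \<or> c = r" by auto
  then have "(\<lambda>z. \<alpha> * uni c z + \<beta> * uni r z) = uni r"
    using \<alpha>\<beta>(3) by (auto simp: fun_eq_iff simp flip: distrib_right)
  with True realizable_uni_antithetic[OF dist, of r] show ?thesis by simp
next
  case False
  have \<alpha>: "\<alpha> = 1 - \<beta>" using \<alpha>\<beta> by simp
  have eq: "\<alpha> * (real r - real c) = real y"
    using bal by (simp add: \<alpha> algebra_simps)
  \<comment> \<open>Strictness comes from \<open>\<beta> > 0\<close> and gives room for the natural
    number \<open>e\<close> below.\<close>
  have "real y < real r - real c"
  proof -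
    have "real r - real c \<noteq> 0" using eq False by auto
    then have "\<beta> * (real r - real c) > 0" using \<alpha>\<beta>(2) le by simp
    with eq show ?thesis by (simp add: \<alpha> algebra_simps)
  qed
  then have "y + c < r" by linarith
  then obtain e where e: "r = y + c + e + 1"
    using less_imp_Suc_add[of "y + c" r] by auto
  have \<alpha>_eq: "\<alpha> = real y / (real y + real e + 1)"
    using eq by (simp add: e field_simps)
  have \<beta>_eq: "\<beta> = (real e + 1) / (real y + real e + 1)"
    using \<alpha>\<beta>(3) \<alpha>_eq by (simp add: field_simps)
  \<comment> \<open>The weights \<open>(y + c + 1) / (r + 1)\<close> and
    \<open>(e + 1) / (r + 1)\<close> of the two parts are the masses of \<open>uni r\<close> above
    and below the cut at \<open>e + 1\<close>. The first part is balanced because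
    \<open>c + (y + c) + y = 2 * (y + c)\<close>, the second likewise with \<open>e\<close>.\<close>
  have "realizable (y + c) (tri i j (uni c) (uni (y + c)) (uni y))"
    by (rule IH[OF _ balanced_uni[OF dist]]) (auto simp: e)
  from realizable_scale[OF _ realizable_shift[OF this, of "e + 1" j], of "(real y + real c + 1) / (real r + 1)"]
  have 1: "realizable r (\<lambda>l z. (real y + real c + 1) / (real r + 1) *
      ((tri i j (uni c) (uni (y + c)) (uni y))(j := \<lambda>z. if z < e + 1 then 0 else
        tri i j (uni c) (uni (y + c)) (uni y) j (z - (e + 1)))) l z)"
    by (simp add: e add.assoc)
  have "realizable (y + e) (tri i j (uni (y + e)) (uni e) (uni y))"
    by (rule IH[OF _ balanced_uni[OF dist]]) (auto simp: e)
  from realizable_scale[OF _ realizable_shift[OF this, of "c + 1" i], of "(real e + 1) / (real r + 1)"]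
  have 2: "realizable r (\<lambda>l z. (real e + 1) / (real r + 1) *
      ((tri i j (uni (y + e)) (uni e) (uni y))(i := \<lambda>z. if z < c + 1 then 0 else
        tri i j (uni (y + e)) (uni e) (uni y) i (z - (c + 1)))) l z)"
    by (simp add: e add_ac)
  have pos: "real y + real e + 1 > 0" "real y + real c + 1 > 0" "real c + 1 > 0" "real e + 1 > 0" "real r + 1 > 0"
    by (simp_all add: add_nonneg_pos)
  \<comment> \<open>The values of coordinate \<open>i\<close> agree on \<open>{0..c}\<close>, which
    only the first part reaches.\<close>
  have A: "(real y + real c + 1) / (real r + 1) * (1 / (real c + 1))
      = \<alpha> * (1 / (real c + 1)) + \<beta> * (1 / (real r + 1))"
  proof -
    have "(real y + real c + 1) * (real y + real e + 1) = real y * (real r + 1) + (real e + 1) * (real c + 1)"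
      by (simp add: e algebra_simps)
    then show ?thesis using pos unfolding \<alpha>_eq \<beta>_eq by (simp add: divide_simps)
  qed
  have "(real y + real c + 1) / (real r + 1) * ((tri i j (uni c) (uni (y + c)) (uni y))(j := \<lambda>z. if z < e + 1 then 0 else
        tri i j (uni c) (uni (y + c)) (uni y) j (z - (e + 1)))) l z +
      (real e + 1) / (real r + 1) * ((tri i j (uni (y + e)) (uni e) (uni y))(i := \<lambda>z. if z < c + 1 then 0 else
        tri i j (uni (y + e)) (uni e) (uni y) i (z - (c + 1)))) l z
     = tri i j (\<lambda>z. \<alpha> * uni c z + \<beta> * uni r z) (uni r) (uni y) l z" (is "?L = ?R") for l z
  proof (cases rule: tri_cases[OF dist, of l])
    case 1
    then have L: "?L = (real y + real c + 1) / (real r + 1) * uni c z +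
        (real e + 1) / (real r + 1) * (if z < c + 1 then 0 else uni (y + e) (z - (c + 1)))"
      using dist by (simp add: tri_simps[OF dist])
    have R: "?R = \<alpha> * uni c z + \<beta> * uni r z" using 1 by (simp add: tri_simps[OF dist])
    consider "z \<le> c" | "c < z" "z \<le> r" | "r < z" by linarith
    then show ?thesis
    proof cases
      case 1
      then have "uni c z = 1 / (real c + 1)" "uni r z = 1 / (real r + 1)" by (auto simp: uni_def e)
      with 1 A show ?thesis unfolding L R by simp
    next
      case 2
      then show ?thesis using pos unfolding L R unfolding \<beta>_eq
        by (simp add: uni_def e divide_simps)
    next
      case 3
      then show ?thesis unfolding L R by (simp add: uni_def e)
    qed
  next
    case 2
    then show ?thesis using dist pos
      by (auto simp: tri_simps[OF dist] uni_def e divide_simps)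
  next
    case 3
    have "(real y + real c + 1) / (real r + 1) * w + (real e + 1) / (real r + 1) * w = w" for w
      using pos by (simp add: e divide_simps) (simp add: algebra_simps)
    with 3 show ?thesis using dist by (simp add: tri_simps[OF dist])
  qed
  with realizable_add[OF 1 2] show ?thesis by simp
qed

lemma tri_swap: "i \<noteq> j \<Longrightarrow> i \<noteq> k \<Longrightarrow> j \<noteq> k \<Longrightarrow> tri i j f g h = tri i k f h g"
  "i \<noteq> j \<Longrightarrow> i \<noteq> k \<Longrightarrow> j \<noteq> k \<Longrightarrow> tri i j f g h = tri j k g h f"
proof -
  assume d: "i \<noteq> j" "i \<noteq> k" "j \<noteq> k"
  show "tri i j f g h = tri i k f h g"
  proof
    show "tri i j f g h l = tri i k f h g l" for l
      by (rule tri_cases[OF d, of l]) (use d in \<open>auto simp: tri_def\<close>)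
  qed
  show "tri i j f g h = tri j k g h f"
  proof
    show "tri i j f g h l = tri j k g h f l" for l
      by (rule tri_cases[OF d, of l]) (use d in \<open>auto simp: tri_def\<close>)
  qed
qed

text \<open>If two of the three functions vanish at \<open>r\<close>, a layer can be stripped.
  Otherwise two are positive at \<open>r\<close>, so one of the pure ones is \<open>uni r\<close>.
  If both pure ones are, the mixture has mean \<open>0\<close> and the antithetic solution applies;
  if the mixture is one of the two, \<open>realizable_two_tops\<close> does.\<close>

lemma realizable_piece:
  assumes IH: "\<And>s M F. s < r \<Longrightarrow> balanced s M F \<Longrightarrow> realizable s F"
    and dist: "i \<noteq> j" "i \<noteq> k" "j \<noteq> k"
    and le: "c \<le> r" "d \<le> r" "x \<le> r" "y \<le> r"
    and \<alpha>\<beta>: "0 \<le> \<alpha>" "0 \<le> \<beta>" "\<alpha> + \<beta> = 1"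
    and bal: "\<alpha> * real c + \<beta> * real d + real x + real y = 2 * real r"
  shows "realizable r (tri i j (\<lambda>z. \<alpha> * uni c z + \<beta> * uni d z) (uni x) (uni y))" (is "realizable r ?F")
proof -
  have ne: "j \<noteq> i" "k \<noteq> i" "k \<noteq> j" using dist by auto
  have F: "balanced r 1 ?F"
  proof (rule balanced_tri[OF dist])
    show "noninc r (\<lambda>z. \<alpha> * uni c z + \<beta> * uni d z)"
      using le \<alpha>\<beta> by (intro noninc_add noninc_scale noninc_uni)
    have mix: "(\<Sum>z\<le>r. w z * (\<alpha> * uni c z + \<beta> * uni d z)) = \<alpha> * (\<Sum>z\<le>r. w z * uni c z) + \<beta> * (\<Sum>z\<le>r. w z * uni d z)"
      for w :: "nat \<Rightarrow> real"
      by (simp add: sum.distrib sum_distrib_left algebra_simps)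
    show "(\<Sum>z\<le>r. \<alpha> * uni c z + \<beta> * uni d z) = 1"
      using mix[of "\<lambda>_. 1"] le \<alpha>\<beta> by (simp add: sum_uni)
    show "(\<Sum>z\<le>r. real z * (\<alpha> * uni c z + \<beta> * uni d z)) + ((\<Sum>z\<le>r. real z * uni x z) + (\<Sum>z\<le>r. real z * uni y z)) = real r * 1"
      using mix[of real] le bal by (simp add: moment_uni)
  qed (use le in \<open>auto simp: noninc_uni sum_uni\<close>)
  have Fs: "?F i = (\<lambda>z. \<alpha> * uni c z + \<beta> * uni d z)" "?F j = uni x" "?F k = uni y"
    by (rule tri_simps[OF dist])+
  have topx: "x = r" if "uni x r \<noteq> 0" and "x \<le> r" for x
    using that by (auto simp: uni_def split: if_splits)
  \<comment> \<open>Stripping needs \<open>0 < r\<close>. For \<open>r = 0\<close> a function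
    vanishing at \<open>r\<close> could not have mass \<open>1\<close>.\<close>
  have strip: "realizable r ?F" if "?F j' r = 0" "?F k' r = 0" "i' \<noteq> j'" "i' \<noteq> k'" "j' \<noteq> k'" for i' j' k'
  proof (cases "r = 0")
    case True
    have "(\<Sum>x\<le>r. ?F j' x) = 1" using F by (simp add: balanced_def)
    with True that show ?thesis by simp
  next
    case False
    then have "realizable (r - 1) F'" if "balanced (r - 1) M' F'" for F' M'
      using IH[of "r - 1" M' F'] that by simp
    with False F that show ?thesis
      using realizable_strip[where M = 1 and i = i' and j = j' and k = k' and F = ?F] by blast
  qed
  have tops: "realizable r (tri i j' (\<lambda>z. \<alpha> * uni c z + \<beta> * uni d z) (uni r) (uni y'))"
    if "?F i r \<noteq> 0" and bal': "\<alpha> * real c + \<beta> * real d + real y' = real r"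
      and dist': "i \<noteq> j'" "i \<noteq> k'" "j' \<noteq> k'" for j' k' y'
  proof -
    \<comment> \<open>A mixture that is positive at \<open>r\<close> contains \<open>uni r\<close>
      with positive weight, in one of its two places.\<close>
    have "\<beta> > 0 \<and> d = r \<or> \<alpha> > 0 \<and> c = r"
      using that(1) \<alpha>\<beta> le unfolding Fs by (auto simp: uni_def less_le split: if_splits)
    then show ?thesis
    proof (elim disjE conjE)
      assume "\<beta> > 0" "d = r"
      with realizable_two_tops[OF IH dist' le(1) \<alpha>\<beta>(1) _ \<alpha>\<beta>(3), where y = y'] bal' show ?thesis by simp
    next
      assume "\<alpha> > 0" "c = r"
      with realizable_two_tops[OF IH dist' le(2) \<alpha>\<beta>(2), where \<beta> = \<alpha> and y = y'] bal' \<alpha>\<beta>(3) show ?thesis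
        by (simp add: add.commute)
    qed
  qed
  consider "uni x r = 0" "uni y r = 0" | "?F i r = 0" "uni x r = 0" | "?F i r = 0" "uni y r = 0"
    | "uni x r \<noteq> 0" "uni y r \<noteq> 0" | "?F i r \<noteq> 0" "uni x r \<noteq> 0" | "?F i r \<noteq> 0" "uni y r \<noteq> 0"
    by blast
  then show ?thesis
  proof cases
    case 1 then show ?thesis using dist by (intro strip[of j k i]) (auto simp: Fs)
  next
    case 2 then show ?thesis using dist ne by (intro strip[of i j k]) (auto simp: Fs)
  next
    case 3 then show ?thesis using dist ne by (intro strip[of i k j]) (auto simp: Fs)
  next
    case 4
    then have xy: "x = r" "y = r" using topx le by auto
    with bal have "\<alpha> * real c + \<beta> * real d = 0" by simp
    then have "\<alpha> * real c = 0" "\<beta> * real d = 0"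
      using \<alpha>\<beta> by (simp_all add: add_nonneg_eq_0_iff)
    then have "\<alpha> = 0 \<or> c = 0" "\<beta> = 0 \<or> d = 0" by auto
    then have "(\<lambda>z. \<alpha> * uni c z + \<beta> * uni d z) = uni 0"
      using \<alpha>\<beta>(3) by (auto simp: fun_eq_iff simp flip: distrib_right)
    then show ?thesis using realizable_uni_antithetic[of j k i r] dist ne
      by (simp add: tri_swap(2)[OF dist] xy)
  next
    case 5
    then have "x = r" using topx le by auto
    with tops[of y j k] 5 bal dist show ?thesis by simp
  next
    case 6
    then have "y = r" using topx le by auto
    with tops[of x k j] 6 bal dist show ?thesis by (simp add: tri_swap(1)[OF dist])
  qed
qed

text \<open>As \<open>uni a\<close> has mean \<open>a / 2\<close>, the last premise is the moment
  condition. In the manner of Caratheodory's theorem, a multiple of a balanced piece on indices that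
  occur is subtracted until some weight vanishes; the induction is on the number of nonzero
  weights.\<close>

lemma realizable_mix:
  fixes \<Lambda> :: "3 \<Rightarrow> nat \<Rightarrow> real"
  assumes IH: "\<And>s M F. s < r \<Longrightarrow> balanced s M F \<Longrightarrow> realizable s F"
  shows "(\<And>l a. a \<le> r \<Longrightarrow> 0 \<le> \<Lambda> l a) \<Longrightarrow> (\<And>l. (\<Sum>a\<le>r. \<Lambda> l a) = M) \<Longrightarrow>
    (\<Sum>l\<in>UNIV. \<Sum>a\<le>r. real a * \<Lambda> l a) = 2 * real r * M \<Longrightarrow>
    realizable r (\<lambda>l x. \<Sum>a\<le>r. \<Lambda> l a * uni a x)"
proof (induction "card {(l, a). a \<le> r \<and> \<Lambda> l a \<noteq> 0}" arbitrary: \<Lambda> M rule: less_induct)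
  case less
  note nonneg = less.prems(1) and mass = less.prems(2) and mom = less.prems(3)
  show ?case
  proof (cases "M = 0")
    case True
    then have "\<Lambda> l a = 0" if "a \<le> r" for l a
      using mass[of l] nonneg that sum_nonneg_eq_0_iff[of "{..r}" "\<Lambda> l"] by auto
    then show ?thesis by (simp add: realizable.zero)
  next
    case False
    have "M \<ge> 0" using mass[of 1] nonneg by (metis atMost_iff sum_nonneg)
    with False have M: "M > 0" by simp
    define S where "S l = {a. a \<le> r \<and> \<Lambda> l a \<noteq> 0}" for l
    have finS: "finite (S l)" for l by (simp add: S_def)
    have neS: "S l \<noteq> {}" for l
    proof
      assume "S l = {}"
      then have "(\<Sum>a\<le>r. \<Lambda> l a) = 0" by (intro sum.neutral) (auto simp: S_def)
      with mass M show False by simp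
    qed
    define lo where "lo l = Min (S l)" for l
    define hi where "hi l = Max (S l)" for l
    have loS: "lo l \<in> S l" and hiS: "hi l \<in> S l" for l
      unfolding lo_def hi_def using finS neS by (auto intro: Min_in Max_in)
    have lo_le: "lo l \<le> hi l" for l
      unfolding lo_def using finS hiS by (rule Min_le)
    have lo_M: "real (lo l) * M \<le> (\<Sum>a\<le>r. real a * \<Lambda> l a)" for l
      unfolding mass[of l, symmetric] sum_distrib_left
    proof (rule sum_mono)
      fix a assume a: "a \<in> {..r}"
      show "real (lo l) * \<Lambda> l a \<le> real a * \<Lambda> l a"
      proof (cases "\<Lambda> l a = 0")
        case False
        with a have "lo l \<le> a" unfolding lo_def using finS by (intro Min_le) (auto simp: S_def)
        then show ?thesis using a nonneg by (intro mult_right_mono) auto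
      qed simp
    qed
    have hi_M: "(\<Sum>a\<le>r. real a * \<Lambda> l a) \<le> real (hi l) * M" for l
      unfolding mass[of l, symmetric] sum_distrib_left
    proof (rule sum_mono)
      fix a assume a: "a \<in> {..r}"
      show "real a * \<Lambda> l a \<le> real (hi l) * \<Lambda> l a"
      proof (cases "\<Lambda> l a = 0")
        case False
        with a have "a \<le> hi l" unfolding hi_def using finS by (intro Max_ge) (auto simp: S_def)
        then show ?thesis using a nonneg by (intro mult_right_mono) auto
      qed simp
    qed
    have SU: "(\<Sum>l\<in>UNIV. f l) = f 1 + (f 2 + f (3::3))" for f :: "3 \<Rightarrow> real"
      by (rule sum_UNIV_3) auto
    \<comment> \<open>The mean indices of the three coordinates add up to \<open>2 * r\<close>, so
      \<open>2 * r\<close> lies between the sum of the smallest and the sum of the largest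
      indices.\<close>
    have "M * (real (lo 1) + real (lo 2) + real (lo 3)) \<le> M * (2 * real r)"
      using lo_M[of 1] lo_M[of 2] lo_M[of 3] mom by (simp add: SU algebra_simps)
    then have LO: "lo 1 + lo 2 + lo 3 \<le> 2 * r"
      using M by (subst (asm) mult_le_cancel_left_pos) auto
    have "M * (2 * real r) \<le> M * (real (hi 1) + real (hi 2) + real (hi 3))"
      using hi_M[of 1] hi_M[of 2] hi_M[of 3] mom by (simp add: SU algebra_simps)
    then have HI: "2 * r \<le> hi 1 + hi 2 + hi 3"
      using M by (subst (asm) mult_le_cancel_left_pos) auto
    \<comment> \<open>Walk from the smallest to the largest indices, one coordinate at a time; the sum of the
      three indices crosses \<open>2 * r\<close> at one of the steps.\<close>
    obtain i j k x y where dist: "i \<noteq> j" "i \<noteq> k" "j \<noteq> k" and xy: "x \<in> S j" "y \<in> S k"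
      and low: "lo i + x + y \<le> 2 * r" and high: "2 * r \<le> hi i + x + y"
    proof (cases "2 * r \<le> hi 1 + lo 2 + lo 3")
      case True
      with LO loS that[of 1 2 3 "lo 2" "lo 3"] show ?thesis by simp
    next
      case F1: False
      show ?thesis
      proof (cases "2 * r \<le> hi 1 + hi 2 + lo 3")
        case True
        with F1 loS hiS that[of 2 1 3 "hi 1" "lo 3"] show ?thesis by simp
      next
        case False
        with HI hiS that[of 3 1 2 "hi 1" "hi 2"] show ?thesis by simp
      qed
    qed
    define c d where "c = lo i" and "d = hi i"
    have cd: "c \<in> S i" "d \<in> S i" "c \<le> d" using loS hiS lo_le by (auto simp: c_def d_def)
    \<comment> \<open>The weights give coordinate \<open>i\<close> the mean index
      \<open>2 * r - x - y\<close>, which lies between \<open>c\<close> and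
      \<open>d\<close>.\<close>
    obtain \<alpha> \<beta> where \<alpha>\<beta>: "0 \<le> \<alpha>" "0 \<le> \<beta>" "\<alpha> + \<beta> = 1"
      and bal: "\<alpha> * real c + \<beta> * real d + real x + real y = 2 * real r"
    proof (cases "c = d")
      case True
      with low high have "c + x + y = 2 * r" by (simp add: c_def d_def)
      then have "real c + real x + real y = 2 * real r" by linarith
      with that[of 1 0] show ?thesis by simp
    next
      case False
      define \<beta> where "\<beta> = (2 * real r - real c - real x - real y) / (real d - real c)"
      have pos: "real d - real c > 0" using False cd by simp
      have "real c + real x + real y \<le> 2 * real r" "2 * real r \<le> real d + real x + real y"
        using low high unfolding c_def d_def by linarith+
      then have "0 \<le> \<beta>" "\<beta> \<le> 1" using pos by (auto simp: \<beta>_def divide_simps)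
      moreover have "\<beta> * (real d - real c) = 2 * real r - real c - real x - real y"
        using pos by (simp add: \<beta>_def)
      then have "(1 - \<beta>) * real c + \<beta> * real d + real x + real y = 2 * real r"
        by (simp add: algebra_simps)
      ultimately show ?thesis using that[of "1 - \<beta>" \<beta>] by simp
    qed
    define P where "P = tri i j (\<lambda>a. (if a = c then \<alpha> else 0) + (if a = d then \<beta> else 0))
      (\<lambda>a. if a = x then 1 else 0) (\<lambda>a. if a = y then 1 else (0::real))"
    have le: "c \<le> r" "d \<le> r" "x \<le> r" "y \<le> r" using cd xy by (auto simp: S_def)
    have P: "P i = (\<lambda>a. (if a = c then \<alpha> else 0) + (if a = d then \<beta> else 0))"
      "P j = (\<lambda>a. if a = x then 1 else 0)" "P k = (\<lambda>a. if a = y then 1 else 0)"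
      unfolding P_def by (rule tri_simps[OF dist])+
    have sumP: "(\<Sum>a\<le>r. w a * P i a) = \<alpha> * w c + \<beta> * w d"
      "(\<Sum>a\<le>r. w a * P j a) = w x" "(\<Sum>a\<le>r. w a * P k a) = w y" for w
      using le by (simp_all add: P distrib_left sum.distrib if_distrib[of "\<lambda>t. _ * t"] mult.commute cong: if_cong)
    have P_nonneg: "0 \<le> P l a" for l a
      by (rule tri_cases[OF dist, of l]) (use \<alpha>\<beta> in \<open>auto simp: P\<close>)
    have P_supp: "a \<in> S l" if "P l a \<noteq> 0" for l a
      by (rule tri_cases[OF dist, of l]) (use that cd xy in \<open>auto simp: P split: if_splits\<close>)
    have P_mass: "(\<Sum>a\<le>r. P l a) = 1" for l
      by (rule tri_cases[OF dist, of l]) (use sumP[of "\<lambda>_. 1"] \<alpha>\<beta>(3) in auto)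
    have P_mom: "(\<Sum>l\<in>UNIV. \<Sum>a\<le>r. real a * P l a) = 2 * real r"
      using bal by (simp add: sum_UNIV_3[OF dist] sumP)
    have "(\<lambda>l z. \<Sum>a\<le>r. P l a * uni a z) = tri i j (\<lambda>z. \<alpha> * uni c z + \<beta> * uni d z) (uni x) (uni y)"
    proof (intro ext)
      fix l z
      show "(\<Sum>a\<le>r. P l a * uni a z) = tri i j (\<lambda>z. \<alpha> * uni c z + \<beta> * uni d z) (uni x) (uni y) l z"
        by (rule tri_cases[OF dist, of l])
          (use sumP[of "\<lambda>a. uni a z"] in \<open>simp_all add: tri_simps[OF dist] mult.commute\<close>)
    qed
    with realizable_piece[OF IH dist le \<alpha>\<beta> bal]
    have realP: "realizable r (\<lambda>l z. \<Sum>a\<le>r. P l a * uni a z)" by simp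
    define Q where "Q = {(l, a). a \<le> r \<and> P l a \<noteq> 0}"
    have finQ: "finite Q"
      by (rule finite_subset[of _ "UNIV \<times> {..r}"]) (auto simp: Q_def)
    have neQ: "Q \<noteq> {}" using le by (auto simp: Q_def P intro!: exI[of _ j] exI[of _ x])
    \<comment> \<open>The largest multiple of \<open>P\<close> that fits below \<Lambda>. The index
      attaining the minimum loses all its weight.\<close>
    define \<kappa> where "\<kappa> = Min ((\<lambda>(l, a). \<Lambda> l a / P l a) ` Q)"
    have "\<kappa> \<in> (\<lambda>(l, a). \<Lambda> l a / P l a) ` Q"
      unfolding \<kappa>_def using finQ neQ by (intro Min_in) auto
    then obtain l\<^sub>0 a\<^sub>0 where Q0: "a\<^sub>0 \<le> r" "P l\<^sub>0 a\<^sub>0 \<noteq> 0" and \<kappa>0: "\<kappa> = \<Lambda> l\<^sub>0 a\<^sub>0 / P l\<^sub>0 a\<^sub>0"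
      by (auto simp: Q_def)
    have \<kappa>_nonneg: "0 \<le> \<kappa>" using nonneg[OF Q0(1)] P_nonneg by (simp add: \<kappa>0)
    define \<Lambda>' where "\<Lambda>' l a = \<Lambda> l a - \<kappa> * P l a" for l a
    have nonneg': "0 \<le> \<Lambda>' l a" if "a \<le> r" for l a
    proof (cases "P l a = 0")
      case False
      with that have "\<kappa> \<le> \<Lambda> l a / P l a"
        unfolding \<kappa>_def using finQ by (intro Min_le) (auto simp: Q_def)
      then show ?thesis using False P_nonneg[of l a] by (simp add: \<Lambda>'_def field_simps)
    qed (use nonneg that in \<open>simp add: \<Lambda>'_def\<close>)
    have mass': "(\<Sum>a\<le>r. \<Lambda>' l a) = M - \<kappa>" for l
      using mass P_mass by (simp add: \<Lambda>'_def sum_subtractf flip: sum_distrib_left)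
    have "(\<Sum>l\<in>UNIV. \<Sum>a\<le>r. real a * \<Lambda>' l a)
        = (\<Sum>l\<in>UNIV. \<Sum>a\<le>r. real a * \<Lambda> l a) - \<kappa> * (\<Sum>l\<in>UNIV. \<Sum>a\<le>r. real a * P l a)"
      by (simp add: \<Lambda>'_def sum_subtractf sum_distrib_left algebra_simps)
    then have mom': "(\<Sum>l\<in>UNIV. \<Sum>a\<le>r. real a * \<Lambda>' l a) = 2 * real r * (M - \<kappa>)"
      by (simp add: mom P_mom algebra_simps)
    have "{(l, a). a \<le> r \<and> \<Lambda>' l a \<noteq> 0} \<subset> {(l, a). a \<le> r \<and> \<Lambda> l a \<noteq> 0}"
    proof
      show "{(l, a). a \<le> r \<and> \<Lambda>' l a \<noteq> 0} \<subseteq> {(l, a). a \<le> r \<and> \<Lambda> l a \<noteq> 0}"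
        using P_supp by (auto simp: \<Lambda>'_def S_def)
      have "\<Lambda>' l\<^sub>0 a\<^sub>0 = 0" "\<Lambda> l\<^sub>0 a\<^sub>0 \<noteq> 0"
        using Q0 P_supp[OF Q0(2)] by (auto simp: \<Lambda>'_def \<kappa>0 S_def)
      with Q0 show "{(l, a). a \<le> r \<and> \<Lambda>' l a \<noteq> 0} \<noteq> {(l, a). a \<le> r \<and> \<Lambda> l a \<noteq> 0}"
        by blast
    qed
    moreover have "finite {(l :: 3, a). a \<le> r \<and> \<Lambda> l a \<noteq> 0}"
      by (rule finite_subset[of _ "UNIV \<times> {..r}"]) auto
    ultimately have "card {(l, a). a \<le> r \<and> \<Lambda>' l a \<noteq> 0} < card {(l, a). a \<le> r \<and> \<Lambda> l a \<noteq> 0}"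
      by (intro psubset_card_mono)
    from realizable_add[OF less.hyps[OF this nonneg' mass' mom'] realizable_scale[OF \<kappa>_nonneg realP]]
    show ?thesis
      by (simp add: \<Lambda>'_def sum_subtractf left_diff_distrib sum_distrib_left mult.assoc)
  qed
qed

section \<open>The theorem for three variables\<close>

definition jumps :: "(nat \<Rightarrow> real) \<Rightarrow> nat \<Rightarrow> real" where
  "jumps f a = (real a + 1) * (f a - f (Suc a))"

lemma
  assumes f: "noninc r f"
  shows jumps_nonneg: "0 \<le> jumps f a"
    and sum_jumps_uni: "(\<Sum>a\<le>r. jumps f a * uni a x) = f x"
    and sum_jumps: "(\<Sum>a\<le>r. jumps f a) = (\<Sum>x\<le>r. f x)"
    and moment_jumps: "(\<Sum>a\<le>r. real a * jumps f a) = 2 * (\<Sum>x\<le>r. real x * f x)"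
proof -
  show "0 \<le> jumps f a" using noninc_Suc[OF f, of a] by (simp add: jumps_def)
  show f_eq: "(\<Sum>a\<le>r. jumps f a * uni a x) = f x" for x
    unfolding jumps_def by (rule noninc_eq_sum_uni[OF f, symmetric])
  have sums: "(\<Sum>x\<le>r. w x * f x) = (\<Sum>a\<le>r. jumps f a * (\<Sum>x\<le>r. w x * uni a x))" for w
    by (simp add: sum_distrib_left mult_ac flip: f_eq) (rule sum.swap)
  show "(\<Sum>a\<le>r. jumps f a) = (\<Sum>x\<le>r. f x)"
    using sums[of "\<lambda>_. 1"] by (simp add: sum_uni)
  show "(\<Sum>a\<le>r. real a * jumps f a) = 2 * (\<Sum>x\<le>r. real x * f x)"
    unfolding sums by (simp add: moment_uni sum_distrib_left mult.commute)
qed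

text \<open>Strong induction on \<open>r\<close>: the weights \<open>jumps\<close> express each
  function through uniform distributions, and the pieces in \<open>realizable_mix\<close> use the
  theorem for smaller sums only.\<close>

theorem realizable_balanced: "balanced r M F \<Longrightarrow> realizable r F"
proof (induction r arbitrary: M F rule: less_induct)
  case (less r)
  then have ni: "noninc r (F l)" for l by (auto simp: balanced_def)
  have "realizable r (\<lambda>l x. \<Sum>a\<le>r. jumps (F l) a * uni a x)"
  proof (rule realizable_mix)
    show "realizable s F'" if "s < r" "balanced s M' F'" for s M' F'
      using less.IH that .
    show "0 \<le> jumps (F l) a" for l a by (rule jumps_nonneg[OF ni])
    show "(\<Sum>a\<le>r. jumps (F l) a) = M" for l
      using less.prems sum_jumps[OF ni[of l]] by (simp add: balanced_def)
    show "(\<Sum>l\<in>UNIV. \<Sum>a\<le>r. real a * jumps (F l) a) = 2 * real r * M"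
      using less.prems by (simp add: balanced_def moment_jumps[OF ni] flip: sum_distrib_left)
  qed
  then show ?case by (simp add: sum_jumps_uni[OF ni])
qed

section \<open>Sums with nonincreasing law\<close>

lemma dist_123: "(1::3) \<noteq> 2" "(1::3) \<noteq> 3" "(2::3) \<noteq> 3"
  by auto

lemmas tri_123 = tri_simps[OF dist_123]

text \<open>For the sum \<open>a + b\<close> the indices \<open>a\<close>, \<open>b\<close>,
  \<open>a + b\<close> are balanced, so uniform variables on \<open>{0..a}\<close> and
  \<open>{0..b}\<close> can be coupled to have a uniform sum. After the shift the third coordinate
  is \<open>r\<close> minus this sum.\<close>

lemma realizable_uni_sum:
  assumes "a + b \<le> r"
  shows "realizable r (tri 1 2 (uni a) (uni b) (\<lambda>z. if z \<le> r then uni (a + b) (r - z) else 0))"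
proof -
  have "realizable (a + b) (tri 1 2 (uni a) (uni b) (uni (a + b)))"
    by (rule realizable_balanced[OF balanced_uni[OF dist_123]]) auto
  from realizable_shift[OF this, of "r - (a + b)" 3] assms
  have "realizable r ((tri 1 2 (uni a) (uni b) (uni (a + b)))
      (3 := \<lambda>z. if z < r - (a + b) then 0 else tri 1 2 (uni a) (uni b) (uni (a + b)) 3 (z - (r - (a + b)))))"
    by simp
  also have "(tri 1 2 (uni a) (uni b) (uni (a + b)))
      (3 := \<lambda>z. if z < r - (a + b) then 0 else tri 1 2 (uni a) (uni b) (uni (a + b)) 3 (z - (r - (a + b))))
    = tri 1 2 (uni a) (uni b) (\<lambda>z. if z \<le> r then uni (a + b) (r - z) else 0)"
  proof (intro ext)
    fix l z
    show "((tri 1 2 (uni a) (uni b) (uni (a + b)))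
      (3 := \<lambda>z. if z < r - (a + b) then 0 else tri 1 2 (uni a) (uni b) (uni (a + b)) 3 (z - (r - (a + b))))) l z
    = tri 1 2 (uni a) (uni b) (\<lambda>z. if z \<le> r then uni (a + b) (r - z) else 0) l z"
      by (rule tri_cases[OF dist_123, of l]) (use assms in \<open>auto simp: tri_123 uni_def\<close>)
  qed
  finally show ?thesis .
qed

text \<open>Indices with \<open>a + b \<le> r\<close> could be merged to \<open>uni (a + b)\<close>. A fraction \<open>\<theta>\<close> of them
  is used instead to compensate the indices with \<open>a + b > r\<close>, so that together with these the sum
  is uniform on \<open>{0, \<dots>, r}\<close>.\<close>

lemma realizable_merge:
  assumes f: "noninc r f" "(\<Sum>x\<le>r. f x) = 1" and g: "noninc r g" "(\<Sum>x\<le>r. g x) = 1"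
    and mom: "2 * ((\<Sum>x\<le>r. real x * f x) + (\<Sum>x\<le>r. real x * g x)) \<le> real r"
  obtains h where "noninc r h" "realizable r (tri 1 2 f g (\<lambda>z. if z \<le> r then h (r - z) else 0))"
proof -
  define A where "A = {..r} \<times> {..r}"
  have finA: "finite A" by (simp add: A_def)
  define w where "w p = jumps f (fst p) * jumps g (snd p)" for p
  have w_nonneg: "0 \<le> w p" for p
    by (simp add: w_def jumps_nonneg[OF f(1)] jumps_nonneg[OF g(1)])
  have sum_w: "(\<Sum>p\<in>A. w p * (u (fst p) * v (snd p)))
      = (\<Sum>a\<le>r. jumps f a * u a) * (\<Sum>b\<le>r. jumps g b * v b)" for u v
    unfolding A_def w_def sum_product sum.cartesian_product by (simp add: mult_ac case_prod_unfold)
  have sum_jumps': "(\<Sum>a\<le>r. jumps f a) = 1" "(\<Sum>a\<le>r. jumps g a) = 1"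
    using sum_jumps[OF f(1)] sum_jumps[OF g(1)] f g by auto
  have sum_w1: "(\<Sum>p\<in>A. w p * u (fst p)) = (\<Sum>a\<le>r. jumps f a * u a)" for u
    using sum_w[of u "\<lambda>_. 1"] sum_jumps' by simp
  have sum_w2: "(\<Sum>p\<in>A. w p * v (snd p)) = (\<Sum>b\<le>r. jumps g b * v b)" for v
    using sum_w[of "\<lambda>_. 1" v] sum_jumps' by simp
  \<comment> \<open>The excess of \<open>a + b\<close> over \<open>r\<close> for the index pair
    \<open>(a, b)\<close>. By the moment hypothesis its average under the product weights
    \<open>w\<close> is at most \<open>0\<close>.\<close>
  define e where "e p = real (fst p) + real (snd p) - real r" for p :: "nat \<times> nat"
  have "(\<Sum>p\<in>A. w p * e p) = (\<Sum>p\<in>A. w p * real (fst p)) + (\<Sum>p\<in>A. w p * real (snd p)) - real r * (\<Sum>p\<in>A. w p)"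
    by (simp add: e_def algebra_simps sum.distrib sum_subtractf sum_distrib_left)
  also have "\<dots> \<le> 0"
    using moment_jumps[OF f(1)] moment_jumps[OF g(1)] mom sum_w1[of "\<lambda>_. 1"] sum_w1[of real] sum_w2[of real] sum_jumps'
    by (simp add: mult.commute)
  finally have w_e: "(\<Sum>p\<in>A. w p * e p) \<le> 0" .
  define Ep where "Ep = (\<Sum>p\<in>A. if e p > 0 then w p * e p else 0)"
  define En where "En = (\<Sum>p\<in>A. if e p > 0 then 0 else w p * - e p)"
  have "Ep - En = (\<Sum>p\<in>A. w p * e p)"
    unfolding Ep_def En_def sum_subtractf[symmetric] by (intro sum.cong) auto
  with w_e have Ep_le: "Ep \<le> En" by simp
  have Ep: "0 \<le> Ep" unfolding Ep_def by (intro sum_nonneg) (auto simp: w_nonneg)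
  define \<theta> where "\<theta> = (if En = 0 then 0 else Ep / En)"
  have \<theta>: "0 \<le> \<theta>" "\<theta> \<le> 1" "\<theta> * En = Ep"
    using Ep Ep_le by (auto simp: \<theta>_def divide_simps)
  \<comment> \<open>\<open>u\<close> takes all pairs with positive excess and the fraction \<theta>
    of the others, so that its total excess is \<open>0\<close>. The rest \<open>v\<close> is
    nonzero only where \<open>a + b \<le> r\<close>.\<close>
  define u where "u p = (if e p > 0 then w p else \<theta> * w p)" for p
  define v where "v p = (if e p > 0 then 0 else (1 - \<theta>) * w p)" for p
  have uv: "u p + v p = w p" for p by (simp add: u_def v_def algebra_simps)
  have u_nonneg: "0 \<le> u p" and v_nonneg: "0 \<le> v p" for p
    using \<theta> by (auto simp: u_def v_def w_nonneg)
  have u_e: "(\<Sum>p\<in>A. u p * e p) = 0"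
  proof -
    have "(\<Sum>p\<in>A. u p * e p) = Ep - \<theta> * En"
      unfolding Ep_def En_def sum_distrib_left sum_subtractf[symmetric]
      by (intro sum.cong) (auto simp: u_def)
    with \<theta> show ?thesis by simp
  qed
  define m where "m = (\<Sum>p\<in>A. u p)"
  have m: "0 \<le> m" unfolding m_def by (intro sum_nonneg u_nonneg)
  have le: "fst p \<le> r" "snd p \<le> r" if "p \<in> A" for p using that by (auto simp: A_def)
  have swap: "(\<Sum>x\<le>r. c x * (\<Sum>p\<in>A. u p * uni (s p) x)) = (\<Sum>p\<in>A. u p * (\<Sum>x\<le>r. c x * uni (s p) x))" for c s
    by (simp add: sum_distrib_left mult_ac) (rule sum.swap)
  \<comment> \<open>As the total excess is \<open>0\<close>, the means \<open>a / 2\<close>,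
    \<open>b / 2\<close> and \<open>r / 2\<close> add up to \<open>r\<close> on average over
    \<open>u\<close>.\<close>
  have 1: "realizable r (tri 1 2 (\<lambda>x. \<Sum>p\<in>A. u p * uni (fst p) x) (\<lambda>x. \<Sum>p\<in>A. u p * uni (snd p) x) (\<lambda>x. m * uni r x))"
  proof (rule realizable_balanced[OF balanced_tri[OF dist_123]])
    show "noninc r (\<lambda>x. \<Sum>p\<in>A. u p * uni (fst p) x)" "noninc r (\<lambda>x. \<Sum>p\<in>A. u p * uni (snd p) x)"
      "noninc r (\<lambda>x. m * uni r x)"
      by (intro noninc_sum noninc_scale noninc_uni u_nonneg m le order_refl; assumption)+
    show "(\<Sum>x\<le>r. \<Sum>p\<in>A. u p * uni (fst p) x) = m" "(\<Sum>x\<le>r. \<Sum>p\<in>A. u p * uni (snd p) x) = m"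
      using swap[of "\<lambda>_. 1" fst] swap[of "\<lambda>_. 1" snd] by (simp_all add: sum_uni le m_def)
    show "(\<Sum>x\<le>r. m * uni r x) = m"
      by (simp add: sum_uni flip: sum_distrib_left)
    have "(\<Sum>x\<le>r. real x * (m * uni r x)) = m * (\<Sum>x\<le>r. real x * uni r x)"
      by (simp add: sum_distrib_left mult_ac)
    then have "(\<Sum>x\<le>r. real x * (m * uni r x)) = m * real r / 2"
      by (simp add: moment_uni)
    moreover have "(\<Sum>p\<in>A. u p * (real (fst p) / 2)) + (\<Sum>p\<in>A. u p * (real (snd p) / 2))
        = (\<Sum>p\<in>A. u p * e p / 2 + u p * (real r / 2))"
      unfolding e_def sum.distrib[symmetric] by (intro sum.cong) (auto simp: field_simps)
    moreover have "\<dots> = (\<Sum>p\<in>A. u p * e p) / 2 + m * real r / 2"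
      by (simp add: sum.distrib m_def sum_divide_distrib sum_distrib_right)
    ultimately show "(\<Sum>x\<le>r. real x * (\<Sum>p\<in>A. u p * uni (fst p) x)) +
      ((\<Sum>x\<le>r. real x * (\<Sum>p\<in>A. u p * uni (snd p) x)) + (\<Sum>x\<le>r. real x * (m * uni r x))) = real r * m"
      unfolding swap using u_e by (simp add: moment_uni le mult.commute)
  qed
  have 2: "realizable r (\<lambda>l x. \<Sum>p\<in>A. v p * tri 1 2 (uni (fst p)) (uni (snd p))
      (\<lambda>z. if z \<le> r then uni (fst p + snd p) (r - z) else 0) l x)"
  proof (rule realizable_sum)
    fix p assume "p \<in> A"
    show "realizable r (\<lambda>l x. v p * tri 1 2 (uni (fst p)) (uni (snd p))
      (\<lambda>z. if z \<le> r then uni (fst p + snd p) (r - z) else 0) l x)"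
    proof (cases "e p > 0")
      case True
      then show ?thesis by (simp add: v_def realizable.zero)
    next
      case False
      then have "fst p + snd p \<le> r" unfolding e_def by linarith
      then show ?thesis by (intro realizable_scale realizable_uni_sum v_nonneg)
    qed
  qed
  \<comment> \<open>Reflection at \<open>r\<close> fixes \<open>uni r\<close> on
    \<open>{0..r}\<close>, so the third coordinate of the first part appears unchanged.\<close>
  define h where "h x = m * uni r x + (\<Sum>p\<in>A. v p * uni (fst p + snd p) x)" for x
  have "noninc r (\<lambda>x. v p * uni (fst p + snd p) x)" for p
  proof (cases "e p > 0")
    case True
    then show ?thesis by (simp add: v_def noninc_zero)
  next
    case False
    then have "fst p + snd p \<le> r" unfolding e_def by linarith
    then show ?thesis by (intro noninc_scale noninc_uni v_nonneg)
  qed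
  from noninc_add[OF noninc_scale[OF m noninc_uni[OF order_refl]] noninc_sum[OF this]]
  have "noninc r h" unfolding h_def .
  moreover have "(tri 1 2 (\<lambda>x. \<Sum>p\<in>A. u p * uni (fst p) x) (\<lambda>x. \<Sum>p\<in>A. u p * uni (snd p) x) (\<lambda>x. m * uni r x)) l x
     + (\<Sum>p\<in>A. v p * tri 1 2 (uni (fst p)) (uni (snd p))
      (\<lambda>z. if z \<le> r then uni (fst p + snd p) (r - z) else 0) l x)
     = tri 1 2 f g (\<lambda>z. if z \<le> r then h (r - z) else 0) l x" for l x
  proof (cases rule: tri_cases[OF dist_123, of l])
    case 1
    then show ?thesis
      by (simp add: tri_123 sum_w1[of "\<lambda>a. uni a x"] uv sum_jumps_uni[OF f(1)] flip: sum.distrib distrib_right)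
  next
    case 2
    then show ?thesis
      by (simp add: tri_123 sum_w2[of "\<lambda>a. uni a x"] uv sum_jumps_uni[OF g(1)] flip: sum.distrib distrib_right)
  next
    case 3
    then show ?thesis
      by (simp add: tri_123 h_def) (simp add: uni_def)
  qed
  with realizable_add[OF 1 2] have "realizable r (tri 1 2 f g (\<lambda>z. if z \<le> r then h (r - z) else 0))"
    by simp
  ultimately show ?thesis by (rule that)
qed

section \<open>From realizable triples to joint distributions\<close>

lemma finite_sum_eq: "finite {t :: 3 \<Rightarrow> nat. (\<Sum>l\<in>UNIV. t l) = r}"
proof (rule finite_subset)
  show "{t :: 3 \<Rightarrow> nat. (\<Sum>l\<in>UNIV. t l) = r} \<subseteq> PiE UNIV (\<lambda>_. {..r})"
    by (auto simp: PiE_UNIV_domain intro: member_le_sum)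
qed (simp add: finite_PiE)

lemma realizable_weights:
  assumes "realizable r F"
  shows "\<exists>W. (\<forall>t. 0 \<le> W t) \<and> (\<forall>t. W t \<noteq> 0 \<longrightarrow> (\<Sum>l\<in>UNIV. t l) = r) \<and>
    (\<forall>l x. F l x = (\<Sum>t\<in>{t. (\<Sum>l\<in>UNIV. t l) = r \<and> t l = x}. W t))"
  using assms
proof (induction rule: realizable.induct)
  case zero
  show ?case by (rule exI[of _ "\<lambda>_. 0"]) auto
next
  case (step F c t)
  then obtain W where W: "\<And>t. 0 \<le> W t" "\<And>t. W t \<noteq> 0 \<Longrightarrow> (\<Sum>l\<in>UNIV. t l) = r"
    "\<And>l x. F l x = (\<Sum>t\<in>{t. (\<Sum>l\<in>UNIV. t l) = r \<and> t l = x}. W t)" by auto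
  show ?case
  proof (intro exI[of _ "\<lambda>s. W s + (if s = t then c else 0)"] conjI allI)
    fix l :: 3 and x
    have "finite {t. (\<Sum>l\<in>UNIV. t l) = r \<and> t l = x}"
      by (rule finite_subset[OF _ finite_sum_eq[of r]]) auto
    then show "F l x + (if x = t l then c else 0)
      = (\<Sum>s\<in>{s. (\<Sum>l\<in>UNIV. s l) = r \<and> s l = x}. W s + (if s = t then c else 0))"
      using step(3) by (simp add: W(3) sum.distrib)
  qed (use W step in auto)
qed

lemma realizable_coupling:
  assumes F: "realizable r F" and mass: "(\<Sum>x\<le>r. F l\<^sub>0 x) = 1"
  obtains J where "\<And>t. t \<in> set_pmf J \<Longrightarrow> (\<Sum>l\<in>UNIV. t l) = r"
    "\<And>l x. pmf (map_pmf (\<lambda>t. t l) J) x = F l x"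
proof -
  define D where "D = {t :: 3 \<Rightarrow> nat. (\<Sum>l\<in>UNIV. t l) = r}"
  have finD: "finite D" unfolding D_def by (rule finite_sum_eq)
  obtain W where W: "\<And>t. 0 \<le> W t" "\<And>t. W t \<noteq> 0 \<Longrightarrow> t \<in> D"
    "\<And>l x. F l x = (\<Sum>t\<in>{t\<in>D. t l = x}. W t)"
    using realizable_weights[OF F] unfolding D_def by auto
  have W0: "W t = 0" if "t \<notin> D" for t using W(2) that by blast
  have le: "t l \<le> r" if "t \<in> D" for t l
    using that member_le_sum[of l UNIV t] by (auto simp: D_def)
  have "(\<Sum>t\<in>D. W t) = (\<Sum>x\<le>r. \<Sum>t\<in>{t\<in>D. t l\<^sub>0 = x}. W t)"
    by (rule sum.group[symmetric]) (use finD le in auto)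
  also have "\<dots> = 1" using mass by (simp add: W(3))
  finally have sumW: "(\<Sum>t\<in>D. W t) = 1" .
  have "(\<integral>\<^sup>+t. ennreal (W t) \<partial>count_space UNIV) = (\<Sum>t\<in>D. ennreal (W t))"
    using W0 finD by (subst nn_integral_count_space'[of D]) auto
  also have "\<dots> = ennreal (\<Sum>t\<in>D. W t)" using W(1) by (intro sum_ennreal)
  finally have total: "(\<integral>\<^sup>+t. ennreal (W t) \<partial>count_space UNIV) = 1" by (simp add: sumW)
  define J where "J = embed_pmf W"
  have J: "pmf J t = W t" for t unfolding J_def by (rule pmf_embed_pmf[OF W(1) total])
  have setJ: "t \<in> D" if "t \<in> set_pmf J" for t
    using that W(2)[of t] by (simp add: set_pmf_eq J)
  have "pmf (map_pmf (\<lambda>t. t l) J) x = F l x" for l x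
  proof -
    have "pmf (map_pmf (\<lambda>t. t l) J) x = measure J ((\<lambda>t. t l) -` {x})"
      by (simp add: pmf_map)
    also have "\<dots> = measure J {t\<in>D. t l = x}"
      using setJ by (intro measure_pmf.finite_measure_eq_AE) (auto simp: AE_measure_pmf_iff)
    also have "\<dots> = (\<Sum>t\<in>{t\<in>D. t l = x}. W t)"
      using finD by (simp add: measure_measure_pmf_finite J)
    finally show ?thesis by (simp add: W(3))
  qed
  with setJ show ?thesis by (intro that[of J]) (auto simp: D_def)
qed

section \<open>Gluing couplings\<close>

lemma bind_cond_map_pmf:
  "bind_pmf (map_pmf h \<tau>) (\<lambda>s. cond_pmf \<tau> {l. h l = s}) = \<tau>"
proof (rule bind_cond_pmf_cancel)
  show "measure \<tau> {l. h l = s} = measure (map_pmf h \<tau>) {s. h l = s}" if "h l = s" for s l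
  proof -
    have "{s. h l = s} = {h l}" by auto
    then show ?thesis using that by (simp add: vimage_def)
  qed
qed auto

text \<open>Draw \<open>t\<close> from \<open>J\<close>, then a point from \<tau> conditioned on the
  value of \<open>h\<close> that \<open>t\<close> prescribes. By disintegration the second draw has
  law \<tau>.\<close>

lemma marginal_glue:
  assumes "map_pmf h' J = map_pmf h \<tau>"
  shows "bind_pmf J (\<lambda>t. map_pmf f (cond_pmf \<tau> {l. h l = h' t})) = map_pmf f \<tau>"
proof -
  have "bind_pmf J (\<lambda>t. map_pmf f (cond_pmf \<tau> {l. h l = h' t}))
      = map_pmf f (bind_pmf (map_pmf h' J) (\<lambda>s. cond_pmf \<tau> {l. h l = s}))"
    by (simp add: map_bind_pmf bind_map_pmf)
  then show ?thesis by (simp add: assms bind_cond_map_pmf)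
qed

text \<open>For \<open>t\<close> in the support of \<open>J\<close> the fibre has positive mass, so
  the conditioning is proper.\<close>

lemma set_cond_fiber:
  assumes "map_pmf h' J = map_pmf h \<tau>" "t \<in> set_pmf J"
  shows "set_pmf (cond_pmf \<tau> {l. h l = h' t}) = {l\<in>set_pmf \<tau>. h l = h' t}"
proof -
  have "h' t \<in> set_pmf (map_pmf h \<tau>)"
    using assms by (metis imageI set_map_pmf)
  then have "set_pmf \<tau> \<inter> {l. h l = h' t} \<noteq> {}" by auto
  then show ?thesis by (subst set_cond_pmf) auto
qed

lemma sum_pmf_noninc: "noninc r (pmf p) \<Longrightarrow> (\<Sum>x\<le>r. pmf p x) = 1"
proof (rule sum_pmf_eq_1)
  assume "noninc r (pmf p)"
  then have "x \<le> r" if "x \<in> set_pmf p" for x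
    using that noninc_eq_0[of r "pmf p" x] by (cases "r < x") (auto simp: set_pmf_iff)
  then show "set_pmf p \<subseteq> {..r}" by auto
qed simp

text \<open>The law and the mean of the sum belong to the induction: \<open>realizable_merge\<close>
  needs them to attach one more variable, and \<open>2 * j \<le> k\<close> keeps the mean at most
  \<open>r / 2\<close>.\<close>

lemma exists_list_coupling:
  assumes p: "noninc r (pmf p)" and mean: "(\<Sum>x\<le>r. real x * pmf p x) = real r / real k"
    and k: "0 < k" and "2 * j \<le> k"
  shows "\<exists>\<tau>. (\<forall>l\<in>set_pmf \<tau>. length l = j) \<and> (\<forall>i<j. map_pmf (\<lambda>l. l ! i) \<tau> = p) \<and>
    noninc r (pmf (map_pmf sum_list \<tau>)) \<and>
    (\<Sum>x\<le>r. real x * pmf (map_pmf sum_list \<tau>) x) = real j * real r / real k"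
  using assms(4)
proof (induction j)
  case 0
  have "noninc r (pmf (return_pmf 0))"
    by (rule nonincI) (auto simp: pmf_return)
  moreover have "map_pmf sum_list (return_pmf []) = return_pmf (0::nat)" by simp
  ultimately show ?case
    by (intro exI[of _ "return_pmf []"] conjI) (simp_all only: set_return_pmf, auto simp: pmf_return intro!: sum.neutral)
next
  case (Suc j)
  then obtain \<tau> where \<tau>: "\<And>l. l \<in> set_pmf \<tau> \<Longrightarrow> length l = j"
    "\<And>i. i < j \<Longrightarrow> map_pmf (\<lambda>l. l ! i) \<tau> = p"
    and G: "noninc r (pmf (map_pmf sum_list \<tau>))"
    and momG: "(\<Sum>x\<le>r. real x * pmf (map_pmf sum_list \<tau>) x) = real j * real r / real k"
    by auto
  define G where "G = map_pmf sum_list \<tau>"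
  note G = G[folded G_def] and momG = momG[folded G_def]
  have "2 * (real j * real r / real k + real r / real k) = real (2 * Suc j) * real r / real k"
    by (simp add: field_simps) (simp add: add_divide_distrib)
  also have "\<dots> \<le> real r"
  proof -
    have "real (2 * Suc j) * real r \<le> real k * real r"
      using Suc.prems by (intro mult_right_mono) (auto simp del: of_nat_mult)
    then show ?thesis using k by (simp add: divide_simps mult.commute)
  qed
  finally have le: "2 * ((\<Sum>x\<le>r. real x * pmf G x) + (\<Sum>x\<le>r. real x * pmf p x)) \<le> real r"
    by (simp only: momG mean)
  obtain h where h: "noninc r h"
    and F: "realizable r (tri 1 2 (pmf G) (pmf p) (\<lambda>z. if z \<le> r then h (r - z) else 0))"
    by (rule realizable_merge[OF G sum_pmf_noninc[OF G] p sum_pmf_noninc[OF p] le])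
  have mass: "(\<Sum>x\<le>r. tri 1 2 (pmf G) (pmf p) (\<lambda>z. if z \<le> r then h (r - z) else 0) 1 x) = 1"
    by (simp add: tri_123 sum_pmf_noninc[OF G])
  obtain J where J: "\<And>t. t \<in> set_pmf J \<Longrightarrow> (\<Sum>l\<in>UNIV. t l) = r"
    and marg: "\<And>l x. pmf (map_pmf (\<lambda>t. t l) J) x = tri 1 2 (pmf G) (pmf p) (\<lambda>z. if z \<le> r then h (r - z) else 0) l x"
    by (rule realizable_coupling[OF F mass], rule that, blast+)
  have sumJ: "t 1 + (t 2 + t 3) = r" if "t \<in> set_pmf J" for t
    using J[OF that] by (simp add: sum_UNIV_3[OF dist_123])
  have J1: "map_pmf (\<lambda>t. t 1) J = map_pmf sum_list \<tau>"
    by (rule pmf_eqI) (simp only: marg tri_123 G_def)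
  have J2: "map_pmf (\<lambda>t. t 2) J = p"
    by (rule pmf_eqI) (simp only: marg tri_123)
  have J3: "pmf (map_pmf (\<lambda>t. t 3) J) x = (if x \<le> r then h (r - x) else 0)" for x
    by (simp only: marg tri_123)
  \<comment> \<open>The new entry \<open>t 2\<close> goes in front of a list drawn from \<tau>
    conditioned on having sum \<open>t 1\<close>.\<close>
  define \<tau>' where "\<tau>' = bind_pmf J (\<lambda>t. map_pmf ((#) (t 2)) (cond_pmf \<tau> {l. sum_list l = t 1}))"
  note fiber = set_cond_fiber[OF J1]
  have "length l = Suc j" if "l \<in> set_pmf \<tau>'" for l
    using that \<tau>(1) by (auto simp: \<tau>'_def fiber)
  moreover have "map_pmf (\<lambda>l. l ! i) \<tau>' = p" if "i < Suc j" for i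
  proof (cases i)
    case 0
    then show ?thesis
      by (simp add: \<tau>'_def map_bind_pmf pmf.map_comp o_def flip: J2)
        (simp add: map_pmf_def)
  next
    case (Suc i')
    then have "map_pmf (\<lambda>l. l ! i) \<tau>' = bind_pmf J (\<lambda>t. map_pmf (\<lambda>l. l ! i') (cond_pmf \<tau> {l. sum_list l = t 1}))"
      by (simp add: \<tau>'_def map_bind_pmf pmf.map_comp o_def)
    also have "\<dots> = map_pmf (\<lambda>l. l ! i') \<tau>" by (rule marginal_glue[OF J1])
    finally show ?thesis using \<tau>(2)[of i'] that Suc by simp
  qed
  \<comment> \<open>The new sum is \<open>t 2 + t 1 = r - t 3\<close>, and \<open>t 3\<close> has
    the reflection of \<open>h\<close> as its law.\<close>
  moreover have law: "pmf (map_pmf sum_list \<tau>') = h"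
  proof
    fix x
    have "map_pmf sum_list \<tau>' = bind_pmf J (\<lambda>t. map_pmf (\<lambda>l. t 2 + sum_list l) (cond_pmf \<tau> {l. sum_list l = t 1}))"
      by (simp add: \<tau>'_def map_bind_pmf pmf.map_comp o_def)
    also have "\<dots> = bind_pmf J (\<lambda>t. map_pmf (\<lambda>l. r - t 3) (cond_pmf \<tau> {l. sum_list l = t 1}))"
    proof (intro bind_pmf_cong map_pmf_cong HOL.refl)
      fix t l assume t: "t \<in> set_pmf J" and l: "l \<in> set_pmf (cond_pmf \<tau> {l. sum_list l = t 1})"
      then show "t 2 + sum_list l = r - t 3" using sumJ[OF t] by (simp add: fiber)
    qed
    also have "\<dots> = map_pmf (\<lambda>t. r - t 3) J" by (simp add: map_pmf_def)
    finally have eq: "map_pmf sum_list \<tau>' = map_pmf (\<lambda>t. r - t 3) J" .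
    have le: "t 3 \<le> r" if "t \<in> set_pmf J" for t using sumJ[OF that] by simp
    show "pmf (map_pmf sum_list \<tau>') x = h x"
    proof (cases "x \<le> r")
      case True
      have "pmf (map_pmf sum_list \<tau>') x = measure J {t. r - t 3 = x}"
        unfolding eq by (simp add: pmf_map vimage_def)
      also have "\<dots> = measure J {t. t 3 = r - x}"
        using le True by (intro measure_pmf.finite_measure_eq_AE) (auto simp: AE_measure_pmf_iff)
      also have "\<dots> = pmf (map_pmf (\<lambda>t. t 3) J) (r - x)"
        by (simp add: pmf_map vimage_def)
      finally show ?thesis using True by (simp add: J3)
    next
      case False
      then have "x \<notin> set_pmf (map_pmf sum_list \<tau>')" unfolding eq by auto
      with False show ?thesis using noninc_eq_0[OF h, of x] by (simp only: pmf_eq_0_set_pmf[symmetric])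
    qed
  qed
  \<comment> \<open>The third coordinate has mean \<open>r\<close> minus that of \<open>h\<close>,
    so the moment identity for the triple yields the mean of \<open>h\<close>.\<close>
  moreover have "(\<Sum>x\<le>r. real x * h x) = real (Suc j) * real r / real k"
  proof -
    have "(\<Sum>x\<le>r. h x) = 1"
      using sum_pmf_noninc[of r "map_pmf sum_list \<tau>'"] h by (simp add: law)
    then have "(\<Sum>x\<le>r. real r * h x) = real r" by (simp flip: sum_distrib_left)
    moreover have "(\<Sum>z\<le>r. real z * (if z \<le> r then h (r - z) else 0)) = (\<Sum>x\<le>r. real r * h x - real x * h x)"
      by (rule sum.reindex_bij_witness[of _ "\<lambda>z. r - z" "\<lambda>z. r - z"]) (auto simp: of_nat_diff left_diff_distrib)
    ultimately have "(\<Sum>z\<le>r. real z * (if z \<le> r then h (r - z) else 0)) = real r - (\<Sum>x\<le>r. real x * h x)"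
      by (simp add: sum_subtractf)
    with realizable_moment[OF F, of 1] show ?thesis
      unfolding sum_UNIV_3[OF dist_123] tri_123
      by (simp add: momG mean sum_pmf_noninc[OF G] add_divide_distrib distrib_right)
  qed
  ultimately show ?case using h by (intro exI[of _ \<tau>']) simp
qed

text \<open>The variables form two blocks of at most \<open>k / 2\<close> entries and one single
  variable. The two block sums and the single variable have nonincreasing laws with means adding up
  to \<open>r\<close>, so the theorem for three variables couples them.\<close>

lemma exists_coupling_T:
  assumes p: "noninc r (pmf p)" and mean: "(\<Sum>x\<le>r. real x * pmf p x) = real r / real k"
    and k: "3 \<le> k"
  shows "\<exists>\<tau>. distribution_on (T r k) \<tau> \<and> (\<forall>i<k. map_pmf (\<lambda>l. l ! i) \<tau> = p)"
proof -
  define j where "j = k div 2"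
  define j' where "j' = k - 1 - j"
  have jj': "j + j' + 1 = k" "2 * j \<le> k" "2 * j' \<le> k" using k by (auto simp: j_def j'_def)
  obtain \<tau> where \<tau>: "\<And>l. l \<in> set_pmf \<tau> \<Longrightarrow> length l = j"
    "\<And>i. i < j \<Longrightarrow> map_pmf (\<lambda>l. l ! i) \<tau> = p"
    and G: "noninc r (pmf (map_pmf sum_list \<tau>))"
    and momG: "(\<Sum>x\<le>r. real x * pmf (map_pmf sum_list \<tau>) x) = real j * real r / real k"
    using exists_list_coupling[OF p mean _ jj'(2)] k by auto
  obtain \<tau>' where \<tau>': "\<And>l. l \<in> set_pmf \<tau>' \<Longrightarrow> length l = j'"
    "\<And>i. i < j' \<Longrightarrow> map_pmf (\<lambda>l. l ! i) \<tau>' = p"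
    and G': "noninc r (pmf (map_pmf sum_list \<tau>'))"
    and momG': "(\<Sum>x\<le>r. real x * pmf (map_pmf sum_list \<tau>') x) = real j' * real r / real k"
    using exists_list_coupling[OF p mean _ jj'(3)] k by auto
  let ?F = "tri 1 2 (pmf (map_pmf sum_list \<tau>)) (pmf (map_pmf sum_list \<tau>')) (pmf p)"
  have F: "realizable r ?F"
  proof (rule realizable_balanced[OF balanced_tri[OF dist_123 G G' p]])
    have "real j * real r / real k + (real j' * real r / real k + real r / real k) = real (j + j' + 1) * real r / real k"
      by (simp add: distrib_right add_divide_distrib)
    also have "\<dots> = real r" using k by (simp only: jj'(1)) simp
    finally show "(\<Sum>x\<le>r. real x * pmf (map_pmf sum_list \<tau>) x) +
      ((\<Sum>x\<le>r. real x * pmf (map_pmf sum_list \<tau>') x) + (\<Sum>x\<le>r. real x * pmf p x)) = real r * 1"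
      by (simp only: momG momG' mean)
  qed (intro sum_pmf_noninc G G' p)+
  have mass: "(\<Sum>x\<le>r. ?F 1 x) = 1"
    by (simp add: tri_123 sum_pmf_noninc[OF G])
  obtain J where J: "\<And>t. t \<in> set_pmf J \<Longrightarrow> (\<Sum>l\<in>UNIV. t l) = r"
    and marg: "\<And>l x. pmf (map_pmf (\<lambda>t. t l) J) x = ?F l x"
    by (rule realizable_coupling[OF F mass], rule that, blast+)
  have sumJ: "t 1 + (t 2 + t 3) = r" if "t \<in> set_pmf J" for t
    using J[OF that] by (simp add: sum_UNIV_3[OF dist_123])
  have J1: "map_pmf (\<lambda>t. t 1) J = map_pmf sum_list \<tau>"
    by (rule pmf_eqI) (simp only: marg tri_123)
  have J2: "map_pmf (\<lambda>t. t 2) J = map_pmf sum_list \<tau>'"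
    by (rule pmf_eqI) (simp only: marg tri_123)
  have J3: "map_pmf (\<lambda>t. t 3) J = p"
    by (rule pmf_eqI) (simp only: marg tri_123)
  let ?C = "\<lambda>t. cond_pmf \<tau> {l. sum_list l = t 1}" and ?C' = "\<lambda>t. cond_pmf \<tau>' {l. sum_list l = t 2}"
  \<comment> \<open>Given \<open>t\<close>, the two blocks are drawn independently, conditioned on
    the sums \<open>t 1\<close> and \<open>t 2\<close>.\<close>
  define \<rho> where "\<rho> = bind_pmf J (\<lambda>t. bind_pmf (?C t) (\<lambda>l. map_pmf (\<lambda>l'. l @ l' @ [t 3]) (?C' t)))"
  note fiber = set_cond_fiber[OF J1] set_cond_fiber[OF J2]
  have "distribution_on (T r k) \<rho>"
    unfolding distribution_on_def
  proof
    fix l assume "l \<in> set_pmf \<rho>"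
    then obtain t l\<^sub>1 l\<^sub>2 where "t \<in> set_pmf J" "l\<^sub>1 \<in> set_pmf \<tau>" "sum_list l\<^sub>1 = t 1"
      "l\<^sub>2 \<in> set_pmf \<tau>'" "sum_list l\<^sub>2 = t 2" "l = l\<^sub>1 @ l\<^sub>2 @ [t 3]"
      by (auto simp: \<rho>_def fiber)
    then show "l \<in> T r k" using \<tau>(1) \<tau>'(1) sumJ jj'(1) by (auto simp: T_def)
  qed
  moreover have "map_pmf (\<lambda>l. l ! i) \<rho> = p" if i: "i < k" for i
  proof -
    have \<rho>: "map_pmf (\<lambda>l. l ! i) \<rho> = bind_pmf J (\<lambda>t. bind_pmf (?C t) (\<lambda>l. map_pmf (\<lambda>l'. (l @ l' @ [t 3]) ! i) (?C' t)))"
      by (simp add: \<rho>_def map_bind_pmf pmf.map_comp o_def)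
    consider "i < j" | "j \<le> i" "i < j + j'" | "i = j + j'" using i jj'(1) by linarith
    then show ?thesis
    proof cases
      case 1
      have "map_pmf (\<lambda>l. l ! i) \<rho> = bind_pmf J (\<lambda>t. bind_pmf (?C t) (\<lambda>l. map_pmf (\<lambda>l'. l ! i) (?C' t)))"
        unfolding \<rho> using 1 \<tau>(1)
        by (intro bind_pmf_cong map_pmf_cong HOL.refl) (auto simp: fiber nth_append)
      also have "\<dots> = bind_pmf J (\<lambda>t. map_pmf (\<lambda>l. l ! i) (?C t))"
        by (simp add: map_pmf_def)
      also have "\<dots> = map_pmf (\<lambda>l. l ! i) \<tau>" by (rule marginal_glue[OF J1])
      finally show ?thesis using \<tau>(2) 1 by simp
    next
      case 2
      have "map_pmf (\<lambda>l. l ! i) \<rho> = bind_pmf J (\<lambda>t. bind_pmf (?C t) (\<lambda>l. map_pmf (\<lambda>l'. l' ! (i - j)) (?C' t)))"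
        unfolding \<rho> using 2 \<tau>(1) \<tau>'(1)
        by (intro bind_pmf_cong map_pmf_cong HOL.refl) (auto simp: fiber nth_append)
      also have "\<dots> = bind_pmf J (\<lambda>t. map_pmf (\<lambda>l. l ! (i - j)) (?C' t))"
        by simp
      also have "\<dots> = map_pmf (\<lambda>l. l ! (i - j)) \<tau>'" by (rule marginal_glue[OF J2])
      finally show ?thesis using \<tau>'(2)[of "i - j"] 2 by simp
    next
      case 3
      have "map_pmf (\<lambda>l. l ! i) \<rho> = bind_pmf J (\<lambda>t. bind_pmf (?C t) (\<lambda>l. map_pmf (\<lambda>l'. t 3) (?C' t)))"
        unfolding \<rho> using 3 \<tau>(1) \<tau>'(1)
        by (intro bind_pmf_cong map_pmf_cong HOL.refl) (auto simp: fiber nth_append)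
      also have "\<dots> = map_pmf (\<lambda>t. t 3) J" by (simp add: map_pmf_def)
      finally show ?thesis by (simp add: J3)
    qed
  qed
  ultimately show ?thesis by blast
qed

section \<open>Symmetrisation and full support\<close>

lemma permute_list_T:
  assumes "\<sigma> permutes {..<l}" "a \<in> T r l"
  shows "permute_list \<sigma> a \<in> T r l"
proof -
  have "mset (permute_list \<sigma> a) = mset a"
    using assms by (intro mset_permute_list) (auto simp: T_def)
  then have "sum_list (permute_list \<sigma> a) = sum_list a"
    by (simp flip: sum_mset_sum_list)
  with assms show ?thesis by (simp add: T_def)
qed

lemma permute_list_inj:
  assumes "\<sigma> permutes {..<l}" "length a = l" "length b = l" "permute_list \<sigma> a = permute_list \<sigma> b"
  shows "a = b"
proof -
  have "permute_list (inv \<sigma>) (permute_list \<sigma> x) = x" if "length x = l" for x :: "'a list"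
  proof -
    have "permute_list (\<sigma> \<circ> inv \<sigma>) x = permute_list (inv \<sigma>) (permute_list \<sigma> x)"
      using permutes_inv[OF assms(1)] that by (intro permute_list_compose) auto
    then show ?thesis using permutes_inv_o[OF assms(1)] by simp
  qed
  from this[of a] this[of b] assms(2-4) show ?thesis by metis
qed

text \<open>The distribution is averaged over all permutations of the coordinates. These already
  share one law, so the marginal is kept; the identity permutation keeps the support.\<close>

lemma symmetrise:
  assumes \<tau>: "distribution_on (T r k) \<tau>" and marg: "\<And>i. i < k \<Longrightarrow> map_pmf (\<lambda>l. l ! i) \<tau> = p"
    and k: "0 < k"
  obtains \<tau>' where "distribution_on (T r k) \<tau>'" "S_symmetric r k \<tau>'" "marginal \<tau>' = p"
    "set_pmf \<tau> \<subseteq> set_pmf \<tau>'"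
proof -
  define P where "P = {\<sigma>. \<sigma> permutes {..<k}}"
  have idP: "id \<in> P" by (simp add: P_def permutes_id)
  then have neP: "P \<noteq> {}" by blast
  have finP: "finite P" by (simp add: P_def finite_permutations)
  define \<tau>' where "\<tau>' = bind_pmf (pmf_of_set P) (\<lambda>\<sigma>. map_pmf (permute_list \<sigma>) \<tau>)"
  have set: "set_pmf \<tau>' = (\<Union>\<sigma>\<in>P. permute_list \<sigma> ` set_pmf \<tau>)"
    by (simp add: \<tau>'_def finP neP)
  have inT: "l \<in> T r k" if "l \<in> set_pmf \<tau>" for l
    using \<tau> that by (auto simp: distribution_on_def)
  then have len: "length l = k" if "l \<in> set_pmf \<tau>" for l
    using that by (auto simp: T_def)
  have "set_pmf \<tau> \<subseteq> set_pmf \<tau>'"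
    unfolding set using idP by (auto intro!: bexI[of _ id] simp: permute_list_id)
  moreover have dist: "distribution_on (T r k) \<tau>'"
    using inT by (auto simp: distribution_on_def set P_def intro: permute_list_T)
  moreover have "marginal \<tau>' = p"
  proof -
    have "marginal \<tau>' = bind_pmf (pmf_of_set P) (\<lambda>\<sigma>. map_pmf (\<lambda>l. permute_list \<sigma> l ! 0) \<tau>)"
      by (simp add: marginal_def \<tau>'_def map_bind_pmf pmf.map_comp o_def)
    also have "\<dots> = bind_pmf (pmf_of_set P) (\<lambda>\<sigma>. p)"
    proof (intro bind_pmf_cong HOL.refl)
      fix \<sigma> assume "\<sigma> \<in> set_pmf (pmf_of_set P)"
      then have \<sigma>: "\<sigma> permutes {..<k}" using finP neP by (simp add: P_def)
      have "map_pmf (\<lambda>l. permute_list \<sigma> l ! 0) \<tau> = map_pmf (\<lambda>l. l ! \<sigma> 0) \<tau>"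
        using \<sigma> k len by (intro map_pmf_cong HOL.refl permute_list_nth) auto
      also have "\<dots> = p" using permutes_in_image[OF \<sigma>, of 0] k by (intro marg) simp
      finally show "map_pmf (\<lambda>l. permute_list \<sigma> l ! 0) \<tau> = p" .
    qed
    finally show ?thesis by simp
  qed
  moreover have "S_symmetric r k \<tau>'"
    unfolding S_symmetric_def
  proof (intro ballI allI impI)
    fix a \<pi> assume a: "a \<in> T r k" and \<pi>: "\<pi> permutes {..<k}"
    \<comment> \<open>Composition with \<pi> is a bijection of \<open>P\<close>, so permuting once
      more after averaging changes nothing.\<close>
    have inj: "inj_on (\<lambda>\<sigma>. \<sigma> \<circ> \<pi>) P"
    proof (rule inj_onI)
      fix \<sigma> \<sigma>' assume "\<sigma> \<circ> \<pi> = \<sigma>' \<circ> \<pi>"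
      then have "\<sigma> \<circ> (\<pi> \<circ> inv \<pi>) = \<sigma>' \<circ> (\<pi> \<circ> inv \<pi>)" by (simp add: o_assoc)
      then show "\<sigma> = \<sigma>'" by (simp add: permutes_inv_o[OF \<pi>])
    qed
    have "(\<lambda>\<sigma>. \<sigma> \<circ> \<pi>) ` P \<subseteq> P" using \<pi> by (auto simp: P_def intro: permutes_compose)
    then have "(\<lambda>\<sigma>. \<sigma> \<circ> \<pi>) ` P = P" using inj by (rule endo_inj_surj[OF finP])
    then have "map_pmf (\<lambda>\<sigma>. \<sigma> \<circ> \<pi>) (pmf_of_set P) = pmf_of_set P"
      using inj finP neP by (simp add: map_pmf_of_set_inj)
    then have "\<tau>' = bind_pmf (map_pmf (\<lambda>\<sigma>. \<sigma> \<circ> \<pi>) (pmf_of_set P)) (\<lambda>\<sigma>. map_pmf (permute_list \<sigma>) \<tau>)"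
      by (simp add: \<tau>'_def)
    also have "\<dots> = bind_pmf (pmf_of_set P) (\<lambda>\<sigma>. map_pmf (permute_list (\<sigma> \<circ> \<pi>)) \<tau>)"
      by (rule bind_map_pmf)
    also have "\<dots> = bind_pmf (pmf_of_set P) (\<lambda>\<sigma>. map_pmf (\<lambda>l. permute_list \<pi> (permute_list \<sigma> l)) \<tau>)"
      using \<pi> len by (intro bind_pmf_cong map_pmf_cong HOL.refl permute_list_compose) auto
    also have "\<dots> = map_pmf (permute_list \<pi>) \<tau>'"
      by (simp add: \<tau>'_def map_bind_pmf pmf.map_comp o_def)
    finally have inv: "\<tau>' = map_pmf (permute_list \<pi>) \<tau>'" .
    have "pmf \<tau>' (permute_list \<pi> a) = pmf (map_pmf (permute_list \<pi>) \<tau>') (permute_list \<pi> a)"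
      by (subst inv) (rule HOL.refl)
    also have "\<dots> = measure \<tau>' {l. permute_list \<pi> l = permute_list \<pi> a}"
      by (simp add: pmf_map vimage_def)
    also have "\<dots> = measure \<tau>' {a}"
    proof (rule measure_pmf.finite_measure_eq_AE)
      have "l = a" if "l \<in> set_pmf \<tau>'" "permute_list \<pi> l = permute_list \<pi> a" for l
        using dist a that permute_list_inj[OF \<pi>, of l a] by (auto simp: distribution_on_def T_def)
      then show "AE l in \<tau>'. (l \<in> {l. permute_list \<pi> l = permute_list \<pi> a}) = (l \<in> {a})"
        by (auto simp: AE_measure_pmf_iff)
    qed auto
    also have "\<dots> = pmf \<tau>' a" by (simp add: measure_pmf_single)
    finally show "pmf \<tau>' a = pmf \<tau>' (permute_list \<pi> a)" by simp
  qed
  ultimately show ?thesis using that by blast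
qed

section \<open>The uniform distribution on \<open>T r k\<close>\<close>

lemma T_nonempty: "0 < k \<Longrightarrow> T r k \<noteq> {}"
proof -
  assume "0 < k"
  then have "r # replicate (k - 1) 0 \<in> T r k"
    by (simp add: T_def sum_list_replicate)
  then show ?thesis by blast
qed

text \<open>By symmetry all coordinates have the same mean, and the \<open>k\<close> means add up to
  \<open>r\<close>.\<close>

lemma uniform_T:
  assumes k: "0 < k"
  obtains u where "\<And>i. i < k \<Longrightarrow> map_pmf (\<lambda>l. l ! i) (pmf_of_set (T r k)) = u"
    "(\<Sum>x\<le>r. real x * pmf u x) = real r / real k" "\<And>x. r < x \<Longrightarrow> pmf u x = 0"
proof -
  define \<tau> where "\<tau> = pmf_of_set (T r k)"
  have set: "set_pmf \<tau> = T r k" using finite_T T_nonempty[OF k] by (simp add: \<tau>_def)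
  have "S_symmetric r k \<tau>"
    using finite_T T_nonempty[OF k] by (auto simp: S_symmetric_def \<tau>_def permute_list_T)
  then have marg: "map_pmf (\<lambda>l. l ! i) \<tau> = marginal \<tau>" if "i < k" for i
    by (intro marginal_eq_map_nth[OF _ _ that]) (auto simp: distribution_on_def set)
  have le: "l ! i \<le> r" if "l \<in> T r k" "i < k" for l i
    using that member_le_sum_list[of "l ! i" l] by (auto simp: T_def)
  have E: "measure_pmf.expectation (marginal \<tau>) real = (\<Sum>l\<in>T r k. real (l ! i) * pmf \<tau> l)" if "i < k" for i
    unfolding marg[OF that, symmetric] integral_map_pmf
    by (rule integral_measure_pmf_real) (auto simp: finite_T set)
  have "real k * measure_pmf.expectation (marginal \<tau>) real = (\<Sum>i<k. measure_pmf.expectation (marginal \<tau>) real)"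
    by simp
  also have "\<dots> = (\<Sum>i<k. \<Sum>l\<in>T r k. real (l ! i) * pmf \<tau> l)"
    by (rule sum.cong[OF HOL.refl]) (rule E, simp)
  also have "\<dots> = (\<Sum>l\<in>T r k. \<Sum>i<k. real (l ! i) * pmf \<tau> l)" by (rule sum.swap)
  also have "\<dots> = (\<Sum>l\<in>T r k. real r * pmf \<tau> l)"
  proof (rule sum.cong[OF HOL.refl])
    fix l assume "l \<in> T r k"
    then have "(\<Sum>i<k. real (l ! i)) = real r"
      by (auto simp: T_def sum_list_sum_nth atLeast0LessThan)
    then show "(\<Sum>i<k. real (l ! i) * pmf \<tau> l) = real r * pmf \<tau> l"
      by (simp flip: sum_distrib_right)
  qed
  also have "\<dots> = real r"
    using sum_pmf_eq_1[of "T r k" \<tau>] by (simp add: finite_T set flip: sum_distrib_left)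
  finally have mean: "measure_pmf.expectation (marginal \<tau>) real = real r / real k"
    using k by (simp add: field_simps)
  have sub: "set_pmf (marginal \<tau>) \<subseteq> {..r}"
    using le k by (auto simp: marginal_def set)
  have "measure_pmf.expectation (marginal \<tau>) real = (\<Sum>x\<le>r. real x * pmf (marginal \<tau>) x)"
    using sub by (intro integral_measure_pmf_real) auto
  moreover have "pmf (marginal \<tau>) x = 0" if "r < x" for x
    using sub that by (auto simp: pmf_eq_0_set_pmf)
  ultimately show ?thesis using mean marg by (intro that[of "marginal \<tau>"]) (auto simp: \<tau>_def)
qed

lemma pmf_of_noninc:
  assumes f: "noninc r f" "(\<Sum>x\<le>r. f x) = 1"
  obtains p where "pmf p = f"
proof -
  have "(\<integral>\<^sup>+x. ennreal (f x) \<partial>count_space UNIV) = (\<Sum>x\<le>r. ennreal (f x))"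
    using noninc_eq_0[OF f(1)] by (subst nn_integral_count_space'[of "{..r}"]) auto
  also have "\<dots> = ennreal (\<Sum>x\<le>r. f x)"
    by (rule sum_ennreal) (rule noninc_nonneg[OF f(1)])
  finally have "pmf (embed_pmf f) = f"
    using f by (intro ext pmf_embed_pmf noninc_nonneg[OF f(1)]) simp
  then show ?thesis by (rule that)
qed

text \<open>The derivative of the objective vanishes at the interior minimum. Up to powers of
  \<gamma> this says that \<nu> has mean \<open>(m - 1) / k\<close>.\<close>

lemma moment_is_gamma:
  assumes g: "is_gamma m k \<gamma>" and m: "0 < m"
  shows "(\<Sum>i<m. real i * \<gamma> ^ i) = (real m - 1) / real k * (\<Sum>i<m. \<gamma> ^ i)"
proof -
  define c where "c = (real m - 1) / real k"
  have \<gamma>: "0 < \<gamma>" "\<gamma> < 1" and min: "\<And>y. 0 < y \<Longrightarrow> y < 1 \<Longrightarrow> gamma_objective m k \<gamma> \<le> gamma_objective m k y"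
    using g by (auto simp: is_gamma_def is_arg_min_linorder)
  define D where "D = ((\<Sum>i<m. real i * \<gamma> ^ (i - 1)) * \<gamma> powr c - (\<Sum>i<m. \<gamma> ^ i) * (c * \<gamma> powr (c - 1))) / (\<gamma> powr c * \<gamma> powr c)"
  have "((\<lambda>x. (\<Sum>i<m. x ^ i) / x powr c) has_real_derivative D) (at \<gamma>)"
    unfolding D_def using \<gamma>
    by (auto intro!: derivative_eq_intros simp: mult.commute)
  then have "(gamma_objective m k has_real_derivative D) (at \<gamma>)"
    by (simp add: gamma_objective_def[abs_def] c_def)
  \<comment> \<open>The radius \<open>min \<gamma> (1 - \<gamma>)\<close> keeps the neighbourhood
    inside the open unit interval, where \<gamma> is minimal.\<close>
  then have "D = 0"
    by (rule DERIV_local_min[of _ _ _ "min \<gamma> (1 - \<gamma>)"]) (use \<gamma> min in auto)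
  then have "(\<Sum>i<m. real i * \<gamma> ^ (i - 1)) * \<gamma> powr c = (\<Sum>i<m. \<gamma> ^ i) * (c * \<gamma> powr (c - 1))"
    using \<gamma> by (simp add: D_def)
  then have "(\<Sum>i<m. real i * \<gamma> ^ (i - 1)) * \<gamma> * \<gamma> powr (c - 1) = (\<Sum>i<m. \<gamma> ^ i) * c * \<gamma> powr (c - 1)"
    using \<gamma> by (simp add: powr_diff field_simps)
  then have "(\<Sum>i<m. real i * \<gamma> ^ (i - 1)) * \<gamma> = (\<Sum>i<m. \<gamma> ^ i) * c"
    using \<gamma> by simp
  moreover have "(\<Sum>i<m. real i * \<gamma> ^ (i - 1)) * \<gamma> = (\<Sum>i<m. real i * \<gamma> ^ i)"
    unfolding sum_distrib_right
  proof (rule sum.cong[OF HOL.refl])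
    show "real i * \<gamma> ^ (i - 1) * \<gamma> = real i * \<gamma> ^ i" for i by (cases i) auto
  qed
  ultimately show ?thesis by (simp add: c_def mult.commute)
qed

theorem theorem1p4:
  fixes m k :: nat and \<gamma> :: real
  assumes "m \<ge> 2" and "k \<ge> 3"
    and "is_gamma m k \<gamma>"
  shows "\<exists>\<tau>. distribution_on (T (m - 1) k) \<tau> \<and> S_symmetric (m - 1) k \<tau> \<and>
           marginal \<tau> = nu m \<gamma> \<and> (\<forall>t\<in>T (m - 1) k. pmf \<tau> t > 0)"
proof -
  define r where "r = m - 1"
  have m: "m = Suc r" and k: "0 < k" using assms by (auto simp: r_def)
  have \<gamma>: "0 < \<gamma>" "\<gamma> < 1"
    using assms(3) by (auto simp: is_gamma_def is_arg_min_def)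
  define S where "S = (\<Sum>i\<le>r. \<gamma> ^ i)"
  have S: "S > 0" unfolding S_def using \<gamma> by (intro sum_pos) auto
  have nu: "pmf (nu m \<gamma>) i = (if i \<le> r then \<gamma> ^ i / S else 0)" for i
    using pmf_nu[of \<gamma> m i] \<gamma> by (simp add: m S_def less_Suc_eq_le lessThan_Suc_atMost)
  have mass_nu: "(\<Sum>i\<le>r. pmf (nu m \<gamma>) i) = 1"
    by (rule sum_pmf_eq_1) (auto simp: set_pmf_iff nu split: if_splits)
  have "(\<Sum>i\<le>r. real i * pmf (nu m \<gamma>) i) = (\<Sum>i\<le>r. real i * \<gamma> ^ i) / S"
    unfolding sum_divide_distrib by (intro sum.cong) (auto simp: nu)
  also have "\<dots> = real r / real k"
    using moment_is_gamma[OF assms(3)] S by (simp add: m lessThan_Suc_atMost flip: S_def)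
  finally have mean_nu: "(\<Sum>i\<le>r. real i * pmf (nu m \<gamma>) i) = real r / real k" .
  obtain u where u: "\<And>i. i < k \<Longrightarrow> map_pmf (\<lambda>l. l ! i) (pmf_of_set (T r k)) = u"
    "(\<Sum>x\<le>r. real x * pmf u x) = real r / real k" "\<And>x. r < x \<Longrightarrow> pmf u x = 0"
    by (rule uniform_T[OF k, of r], rule that, blast+)
  have "x \<le> r" if "x \<in> set_pmf u" for x
    using that u(3)[of x] by (cases "r < x") (auto simp: set_pmf_iff)
  then have mass_u: "(\<Sum>i\<le>r. pmf u i) = 1"
    by (intro sum_pmf_eq_1) auto
  \<comment> \<open>A lower bound for all drops of \<nu>:
    \<open>\<gamma> ^ x - \<gamma> ^ Suc x\<close> is smallest at \<open>x = r\<close>, and the drop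
    from \<open>r\<close> to \<open>Suc r\<close> is even \<open>\<gamma> ^ r / S\<close>.\<close>
  define \<delta> where "\<delta> = \<gamma> ^ r * (1 - \<gamma>) / S"
  have gap: "pmf (nu m \<gamma>) (Suc x) + \<delta> \<le> pmf (nu m \<gamma>) x" if "x \<le> r" for x
  proof -
    have "\<gamma> ^ r \<le> \<gamma> ^ x" using \<gamma> that by (intro power_decreasing) auto
    then have "\<gamma> ^ r * (1 - \<gamma>) \<le> \<gamma> ^ x * (1 - \<gamma>)" using \<gamma> by (intro mult_right_mono) auto
    then have "\<delta> \<le> \<gamma> ^ x * (1 - \<gamma>) / S" unfolding \<delta>_def using S by (intro divide_right_mono) auto
    also have "\<dots> = \<gamma> ^ x / S - \<gamma> ^ Suc x / S"
      by (subst diff_divide_distrib[symmetric]) (simp add: algebra_simps)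
    also have "\<dots> \<le> pmf (nu m \<gamma>) x - pmf (nu m \<gamma>) (Suc x)"
      using that \<gamma> S by (auto simp: nu)
    finally show ?thesis by simp
  qed
  \<comment> \<open>A value of \<open>u\<close> exceeds the next one by at most \<open>1\<close>, so
    \<open>\<epsilon> \<le> \<delta>\<close> keeps the difference below nonincreasing. The bound
    \<open>1 / 2\<close> allows division by \<open>1 - \<epsilon>\<close>.\<close>
  define \<epsilon> where "\<epsilon> = min \<delta> (1 / 2)"
  have \<epsilon>: "0 < \<epsilon>" "\<epsilon> \<le> \<delta>" "\<epsilon> < 1" using \<gamma> S by (auto simp: \<epsilon>_def \<delta>_def)
  define f where "f x = (1 / (1 - \<epsilon>)) * (pmf (nu m \<gamma>) x - \<epsilon> * pmf u x)" for x
  have f: "noninc r f"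
    unfolding f_def
  proof (intro noninc_scale nonincI)
    fix x
    show "pmf (nu m \<gamma>) (Suc x) - \<epsilon> * pmf u (Suc x) \<le> pmf (nu m \<gamma>) x - \<epsilon> * pmf u x"
    proof (cases "x \<le> r")
      case True
      have "\<epsilon> * pmf u x \<le> \<epsilon> * 1" "0 \<le> \<epsilon> * pmf u (Suc x)"
        using \<epsilon> pmf_le_1[of u x] by (intro mult_left_mono mult_nonneg_nonneg; simp)+
      with gap[OF True] \<epsilon> show ?thesis by linarith
    qed (use u(3) in \<open>simp add: nu\<close>)
  qed (use \<epsilon> u(3) in \<open>auto simp: nu\<close>)
  have sum_f: "(\<Sum>x\<le>r. w x * f x) = ((\<Sum>x\<le>r. w x * pmf (nu m \<gamma>) x) - \<epsilon> * (\<Sum>x\<le>r. w x * pmf u x)) / (1 - \<epsilon>)" for w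
    unfolding sum_distrib_left sum_subtractf[symmetric] sum_divide_distrib
    by (intro sum.cong) (auto simp: f_def right_diff_distrib diff_divide_distrib)
  have "(\<Sum>x\<le>r. f x) = 1"
    using sum_f[of "\<lambda>_. 1"] mass_nu mass_u \<epsilon> by simp
  then obtain p where p: "pmf p = f" using pmf_of_noninc[OF f] by blast
  have "(\<Sum>x\<le>r. real x * f x) = (real r / real k - \<epsilon> * (real r / real k)) / (1 - \<epsilon>)"
    by (simp only: sum_f mean_nu u(2))
  also have "\<dots> = (1 - \<epsilon>) * (real r / real k) / (1 - \<epsilon>)"
    by (simp only: left_diff_distrib mult_1_left)
  also have "\<dots> = real r / real k" using \<epsilon> by simp
  finally have mean: "(\<Sum>x\<le>r. real x * pmf p x) = real r / real k"
    by (simp only: p)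
  have "noninc r (pmf p)" using f by (simp only: p)
  from exists_coupling_T[OF this mean assms(2)]
  obtain \<tau> where \<tau>: "distribution_on (T r k) \<tau>" "\<And>i. i < k \<Longrightarrow> map_pmf (\<lambda>l. l ! i) \<tau> = p"
    by blast
  \<comment> \<open>Mixing the uniform distribution back in restores the marginal \<nu> and charges
    every point of \<open>T r k\<close>.\<close>
  define \<rho> where "\<rho> = bind_pmf (bernoulli_pmf \<epsilon>) (\<lambda>b. if b then pmf_of_set (T r k) else \<tau>)"
  have setU: "set_pmf (pmf_of_set (T r k)) = T r k"
    using finite_T T_nonempty[OF k] by simp
  have set\<rho>: "set_pmf \<rho> = T r k"
    using \<tau>(1) \<epsilon> unfolding \<rho>_def distribution_on_def by (auto simp: setU set_pmf_bernoulli split: if_splits)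
  have marg: "map_pmf (\<lambda>l. l ! i) \<rho> = nu m \<gamma>" if "i < k" for i
  proof (rule pmf_eqI)
    fix x
    have "map_pmf (\<lambda>l. l ! i) \<rho> = bind_pmf (bernoulli_pmf \<epsilon>) (\<lambda>b. if b then u else p)"
      unfolding \<rho>_def map_bind_pmf by (intro bind_pmf_cong) (auto simp: u(1)[OF that] \<tau>(2)[OF that])
    then have "pmf (map_pmf (\<lambda>l. l ! i) \<rho>) x = \<epsilon> * pmf u x + (1 - \<epsilon>) * pmf p x"
      using \<epsilon> by (simp add: pmf_bind)
    then show "pmf (map_pmf (\<lambda>l. l ! i) \<rho>) x = pmf (nu m \<gamma>) x"
      using \<epsilon> by (simp add: p f_def)
  qed
  have "distribution_on (T r k) \<rho>" by (simp add: distribution_on_def set\<rho>)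
  then obtain \<tau>' where \<tau>': "distribution_on (T r k) \<tau>'" "S_symmetric r k \<tau>'" "marginal \<tau>' = nu m \<gamma>"
    "set_pmf \<rho> \<subseteq> set_pmf \<tau>'"
    by (rule symmetrise[OF _ marg k])
  then have "\<forall>t\<in>T r k. pmf \<tau>' t > 0"
    by (auto simp: set\<rho> pmf_positive_iff)
  with \<tau>' show ?thesis unfolding r_def[symmetric] by blast
qed

end
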